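(* There exist a Banach space $(X,\|\cdot\|_X)$ and a functional $I\in C^1(X,\mathbb{R})$ satisfying (A1) $I(0)=0$, $I(u)$ is even in $u$ and bounded from below; (A2) $I(u)$ satisfies the $(PS)_c$ condition for all $c<0$ (with $(PS)_0$ not being assumed); (A3) for any $k\in\mathbb{N}$ there exists $A\in\mathcal{E}$ such that $\gamma(A)\ge k$ and $\sup_{u\in A}I(u)<0$; such that there is no sequence $(u_j)_{j=1}^\infty\subset X$ of critical points of $I$ with $$I(u_j)<0\ \text{ for all } j\in\mathbb{N},\qquad I(u_j)\to 0\ \text{ as } j\to\infty,\qquad \operatorname{dist}(u_j,\widehat K_0)\to 0\ \text{ as } j\to\infty.$$
   Context: $X$ is a real Banach space with dual $X^*$; $\mathbb{N}=\{1,2,\dots\}$. A critical point of $I$ is $u\in X$ with $I'(u)=0$. $(PS)_c$: for $c\in\mathbb{R}$, $I$ satisfies $(PS)_c$ if any sequence $(u_j)_{j=1}^\infty\subset X$ with $I(u_j)\to c$ and $\|I'(u_j)\|_{X^*}\to 0$ has a (norm-)convergent subsequence. $\mathcal{E}$ is the family of sets $A\subset X\setminus\{0\}$ that are closed (in $X$) and symmetric with respect to $0$. For $A\in\mathcal{E}$, the (Krasnosel'skii) genus $\gamma(A)$ is the smallest integer $n$ such that there exists an odd continuous map $\zeta\in C(A,\mathbb{R}^n\setminus\{0\})$; if no such map exists for any $n$, $\gamma(A)=\infty$; $\gamma(\emptyset)=0$. $K_0=\{u\in X: I'(u)=0,\ I(u)=0\}$ (which contains $0$), and $\widehat K_0$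 is the connected component of $K_0$ containing $0$. $\operatorname{dist}(u,\widehat K_0)=\inf\{\|u-v\|_X: v\in\widehat K_0\}$. *)

theory Defs
  imports "HOL-Analysis.Analysis" "HOL-Library.Extended_Nat" "HOL-Library.Extended_Real"
begin

text \<open>
  HOL cannot quantify existentially over types, so the existence of a Banach space cannot be
  expressed with the type class \<open>banach\<close>. A normed space is therefore given here by a carrier set
  together with arbitrary operations and a norm; the topological notions are those of the
  library for carrier-based metric spaces and abstract topologies. The values of the operations
  and of functionals outside the carrier are irrelevant.
\<close>

record 'a nvs =
  vcarrier :: "'a set"
  vadd :: "'a \<Rightarrow> 'a \<Rightarrow> 'a"
  vzero :: "'a"
  vscale :: "real \<Rightarrow> 'a \<Rightarrow> 'a"
  vnorm :: "'a \<Rightarrow> real"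

definition vneg :: "'a nvs \<Rightarrow> 'a \<Rightarrow> 'a" where
  "vneg V x = vscale V (- 1) x"

text \<open>The locale \<open>Metric_space\<close> demands symmetry and nonnegativity also outside the carrier,
  whence the case distinction.\<close>

definition vdist :: "'a nvs \<Rightarrow> 'a \<Rightarrow> 'a \<Rightarrow> real" where
  "vdist V x y =
     (if x \<in> vcarrier V \<and> y \<in> vcarrier V then vnorm V (vadd V x (vneg V y)) else 0)"

definition vtopology :: "'a nvs \<Rightarrow> 'a topology" where
  "vtopology V = Metric_space.mtopology (vcarrier V) (vdist V)"

locale real_normed_space =
  fixes V :: "'a nvs"
  assumes zero_closed: "vzero V \<in> vcarrier V"
    and add_closed: "\<lbrakk>x \<in> vcarrier V; y \<in> vcarrier V\<rbrakk> \<Longrightarrow> vadd V x y \<in> vcarrier V"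
    and scale_closed: "x \<in> vcarrier V \<Longrightarrow> vscale V r x \<in> vcarrier V"
    and add_assoc: "\<lbrakk>x \<in> vcarrier V; y \<in> vcarrier V; z \<in> vcarrier V\<rbrakk>
          \<Longrightarrow> vadd V (vadd V x y) z = vadd V x (vadd V y z)"
    and add_commute: "\<lbrakk>x \<in> vcarrier V; y \<in> vcarrier V\<rbrakk> \<Longrightarrow> vadd V x y = vadd V y x"
    and add_zero: "x \<in> vcarrier V \<Longrightarrow> vadd V x (vzero V) = x"
    and add_neg: "x \<in> vcarrier V \<Longrightarrow> vadd V x (vneg V x) = vzero V"
    and scale_one: "x \<in> vcarrier V \<Longrightarrow> vscale V 1 x = x"
    and scale_scale: "x \<in> vcarrier V \<Longrightarrow> vscale V r (vscale V s x) = vscale V (r * s) x"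
    and scale_add_right: "\<lbrakk>x \<in> vcarrier V; y \<in> vcarrier V\<rbrakk>
          \<Longrightarrow> vscale V r (vadd V x y) = vadd V (vscale V r x) (vscale V r y)"
    and scale_add_left: "x \<in> vcarrier V
          \<Longrightarrow> vscale V (r + s) x = vadd V (vscale V r x) (vscale V s x)"
    and norm_eq_zero: "x \<in> vcarrier V \<Longrightarrow> vnorm V x = 0 \<longleftrightarrow> x = vzero V"
    and norm_scale: "x \<in> vcarrier V \<Longrightarrow> vnorm V (vscale V r x) = \<bar>r\<bar> * vnorm V x"
    and norm_triangle: "\<lbrakk>x \<in> vcarrier V; y \<in> vcarrier V\<rbrakk>
          \<Longrightarrow> vnorm V (vadd V x y) \<le> vnorm V x + vnorm V y"

locale real_banach_space = real_normed_space +
  assumes complete: "Metric_space.mcomplete (vcarrier V) (vdist V)"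

text \<open>Elements of the dual space are made extensional, so that each functional on the carrier is
  represented by exactly one HOL function.\<close>

definition vdual :: "'a nvs \<Rightarrow> ('a \<Rightarrow> real) set" where
  "vdual V = {f \<in> extensional (vcarrier V).
     (\<forall>x\<in>vcarrier V. \<forall>y\<in>vcarrier V. f (vadd V x y) = f x + f y) \<and>
     (\<forall>r. \<forall>x\<in>vcarrier V. f (vscale V r x) = r * f x) \<and>
     (\<exists>K. \<forall>x\<in>vcarrier V. \<bar>f x\<bar> \<le> K * vnorm V x)}"

definition dual_norm :: "'a nvs \<Rightarrow> ('a \<Rightarrow> real) \<Rightarrow> real" where
  "dual_norm V f = (SUP x\<in>{x \<in> vcarrier V. vnorm V x \<le> 1}. \<bar>f x\<bar>)"

definition has_frechet_derivative ::
    "'a nvs \<Rightarrow> ('a \<Rightarrow> real) \<Rightarrow> ('a \<Rightarrow> real) \<Rightarrow> 'a \<Rightarrow> bool" where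
  "has_frechet_derivative V I f u \<longleftrightarrow> f \<in> vdual V \<and>
     (\<forall>\<epsilon>>0. \<exists>\<delta>>0. \<forall>h\<in>vcarrier V. vnorm V h < \<delta> \<longrightarrow>
        \<bar>I (vadd V u h) - I u - f h\<bar> \<le> \<epsilon> * vnorm V h)"

text \<open>The derivative is unique if it exists, see \<open>has_frechet_derivative_unique\<close> below.\<close>

definition frechet :: "'a nvs \<Rightarrow> ('a \<Rightarrow> real) \<Rightarrow> 'a \<Rightarrow> 'a \<Rightarrow> real" where
  "frechet V I u = (THE f. has_frechet_derivative V I f u)"

definition C1_functional :: "'a nvs \<Rightarrow> ('a \<Rightarrow> real) \<Rightarrow> bool" where
  "C1_functional V I \<longleftrightarrow>
     (\<forall>u\<in>vcarrier V. \<exists>f. has_frechet_derivative V I f u) \<and>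
     (\<forall>u\<in>vcarrier V. \<forall>\<epsilon>>0. \<exists>\<delta>>0. \<forall>v\<in>vcarrier V. vdist V u v < \<delta> \<longrightarrow>
        dual_norm V (\<lambda>h. frechet V I v h - frechet V I u h) < \<epsilon>)"

definition critical_point :: "'a nvs \<Rightarrow> ('a \<Rightarrow> real) \<Rightarrow> 'a \<Rightarrow> bool" where
  "critical_point V I u \<longleftrightarrow> u \<in> vcarrier V \<and> (\<forall>h\<in>vcarrier V. frechet V I u h = 0)"

definition palais_smale :: "'a nvs \<Rightarrow> ('a \<Rightarrow> real) \<Rightarrow> real \<Rightarrow> bool" where
  "palais_smale V I c \<longleftrightarrow>
     (\<forall>u :: nat \<Rightarrow> 'a. range u \<subseteq> vcarrier V \<longrightarrow>
        (\<lambda>j. I (u j)) \<longlonglongrightarrow> c \<longrightarrow>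
        (\<lambda>j. dual_norm V (frechet V I (u j))) \<longlonglongrightarrow> 0 \<longrightarrow>
        (\<exists>r l. strict_mono r \<and> limitin (vtopology V) (u \<circ> r) l sequentially))"

definition closed_symmetric_sets :: "'a nvs \<Rightarrow> 'a set set" where
  "closed_symmetric_sets V =
     {A. closedin (vtopology V) A \<and> vzero V \<notin> A \<and> (\<forall>x\<in>A. vneg V x \<in> A)}"

text \<open>\<open>Euclidean_space n\<close> is \<open>\<real>\<close> to the power \<open>n\<close>, realised as the sequences vanishing from index
  \<open>n\<close> on. The infimum of the empty set in \<^typ>\<open>enat\<close> is \<open>\<infinity>\<close>, and any other infimum is attained.\<close>

definition genus :: "'a nvs \<Rightarrow> 'a set \<Rightarrow> enat" where
  "genus V A = (INF n \<in> {n. \<exists>\<zeta>.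
       continuous_map (subtopology (vtopology V) A)
         (subtopology (Euclidean_space n) (- {\<lambda>i. 0})) \<zeta> \<and>
       (\<forall>x\<in>A. \<zeta> (vneg V x) = (\<lambda>i. - \<zeta> x i))}. enat n)"

definition K0 :: "'a nvs \<Rightarrow> ('a \<Rightarrow> real) \<Rightarrow> 'a set" where
  "K0 V I = {u. critical_point V I u \<and> I u = 0}"

definition K0_hat :: "'a nvs \<Rightarrow> ('a \<Rightarrow> real) \<Rightarrow> 'a set" where
  "K0_hat V I = connected_component_of_set (subtopology (vtopology V) (K0 V I)) (vzero V)"

definition set_distance :: "'a nvs \<Rightarrow> 'a \<Rightarrow> 'a set \<Rightarrow> real" where
  "set_distance V u S = (INF v\<in>S. vdist V u v)"

definition A1 :: "'a nvs \<Rightarrow> ('a \<Rightarrow> real) \<Rightarrow> bool" where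
  "A1 V I \<longleftrightarrow> I (vzero V) = 0 \<and> (\<forall>u\<in>vcarrier V. I (vneg V u) = I u) \<and>
     bdd_below (I ` vcarrier V)"

definition A2 :: "'a nvs \<Rightarrow> ('a \<Rightarrow> real) \<Rightarrow> bool" where
  "A2 V I \<longleftrightarrow> (\<forall>c<0. palais_smale V I c)"

text \<open>The supremum is taken in the extended reals, where it exists for every \<open>A\<close>.\<close>

definition A3 :: "'a nvs \<Rightarrow> ('a \<Rightarrow> real) \<Rightarrow> bool" where
  "A3 V I \<longleftrightarrow> (\<forall>k::nat. k \<ge> 1 \<longrightarrow>
     (\<exists>A\<in>closed_symmetric_sets V. genus V A \<ge> enat k \<and> (SUP u\<in>A. ereal (I u)) < 0))"

context real_normed_space
begin

lemma neg_closed: "x \<in> vcarrier V \<Longrightarrow> vneg V x \<in> vcarrier V"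
  by (simp add: vneg_def scale_closed)

lemma scale_zero_left:
  assumes "x \<in> vcarrier V" shows "vscale V 0 x = vzero V"
  using scale_add_left[OF assms, of 1 "- 1"] assms
  by (simp add: scale_one add_neg[unfolded vneg_def])

lemma norm_nonneg:
  assumes "x \<in> vcarrier V" shows "0 \<le> vnorm V x"
proof -
  have "vnorm V (vadd V x (vneg V x)) \<le> vnorm V x + vnorm V (vneg V x)"
    by (simp add: assms norm_triangle neg_closed)
  moreover have "vnorm V (vadd V x (vneg V x)) = 0"
    using assms by (simp add: add_neg norm_eq_zero zero_closed)
  moreover have "vnorm V (vneg V x) = vnorm V x"
    using assms by (simp add: vneg_def norm_scale)
  ultimately show ?thesis by simp
qed

lemma Metric_space_vdist: "Metric_space (vcarrier V) (vdist V)"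
proof
  fix x y show "0 \<le> vdist V x y"
    by (simp add: vdist_def norm_nonneg add_closed neg_closed)
next
  fix x y
  show "vdist V x y = vdist V y x"
  proof (cases "x \<in> vcarrier V \<and> y \<in> vcarrier V")
    case True
    then have "vneg V (vadd V x (vneg V y)) = vadd V (vneg V x) y"
      by (simp add: vneg_def scale_add_right scale_closed scale_scale scale_one)
    also have "\<dots> = vadd V y (vneg V x)"
      using True by (simp add: add_commute neg_closed)
    finally have "vnorm V (vadd V y (vneg V x)) = vnorm V (vneg V (vadd V x (vneg V y)))" by simp
    also have "\<dots> = vnorm V (vadd V x (vneg V y))"
      using True norm_scale[of "vadd V x (vneg V y)" "- 1"]
      by (simp add: vneg_def add_closed scale_closed)
    finally show ?thesis using True by (simp add: vdist_def)
  qed (auto simp: vdist_def)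
next
  fix x y assume xy: "x \<in> vcarrier V" "y \<in> vcarrier V"
  have "x = y" if "vadd V x (vneg V y) = vzero V"
  proof -
    have "vadd V (vadd V x (vneg V y)) y = vadd V x (vadd V y (vneg V y))"
      using xy by (simp add: add_assoc neg_closed add_commute)
    then show ?thesis
      using xy that by (metis add_neg add_zero add_commute zero_closed)
  qed
  then show "vdist V x y = 0 \<longleftrightarrow> x = y"
    using xy by (auto simp: vdist_def norm_eq_zero add_closed neg_closed add_neg)
next
  fix x y z assume xyz: "x \<in> vcarrier V" "y \<in> vcarrier V" "z \<in> vcarrier V"
  have "vadd V (vneg V y) (vadd V y (vneg V z)) = vneg V z"
    using xyz by (metis add_assoc add_commute add_neg add_zero neg_closed zero_closed)
  then have "vadd V x (vneg V z) = vadd V (vadd V x (vneg V y)) (vadd V y (vneg V z))"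
    using xyz by (simp add: add_assoc neg_closed add_closed)
  then show "vdist V x z \<le> vdist V x y + vdist V y z"
    using xyz by (simp add: vdist_def norm_triangle add_closed neg_closed)
qed

lemma has_frechet_derivative_unique:
  assumes f: "has_frechet_derivative V I f u" and g: "has_frechet_derivative V I g u"
  shows "f = g"
proof (rule extensionalityI)
  show "f \<in> extensional (vcarrier V)" "g \<in> extensional (vcarrier V)"
    using f g by (auto simp: has_frechet_derivative_def vdual_def)
  fix x assume x: "x \<in> vcarrier V"
  have scale: "f (vscale V r x) = r * f x" "g (vscale V r x) = r * g x" for r
    using f g x by (auto simp: has_frechet_derivative_def vdual_def)
  have "\<bar>f x - g x\<bar> \<le> 0 + e" if "e > 0" for e
  proof -
    define N where "N = vnorm V x + 1"
    have N: "N > 0" "vnorm V x \<le> N" using norm_nonneg[OF x] by (auto simp: N_def)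
    define c where "c = e / (2 * N)"
    have c: "c > 0" using that N by (simp add: c_def)
    obtain d1 where d1: "d1 > 0" "\<And>h. \<lbrakk>h \<in> vcarrier V; vnorm V h < d1\<rbrakk> \<Longrightarrow>
        \<bar>I (vadd V u h) - I u - f h\<bar> \<le> c * vnorm V h"
      using f c unfolding has_frechet_derivative_def by blast
    obtain d2 where d2: "d2 > 0" "\<And>h. \<lbrakk>h \<in> vcarrier V; vnorm V h < d2\<rbrakk> \<Longrightarrow>
        \<bar>I (vadd V u h) - I u - g h\<bar> \<le> c * vnorm V h"
      using g c unfolding has_frechet_derivative_def by blast
    define t where "t = min d1 d2 / (2 * N)"
    have t: "t > 0" using d1 d2 N by (simp add: t_def)
    have "t * vnorm V x \<le> t * N" using t N by simp
    also have "\<dots> < min d1 d2" using N d1(1) d2(1) by (simp add: t_def min_def)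
    finally have "vnorm V (vscale V t x) < min d1 d2" using t x by (simp add: norm_scale)
    then have "\<bar>f (vscale V t x) - g (vscale V t x)\<bar> \<le> 2 * (c * vnorm V (vscale V t x))"
      using d1(2)[OF scale_closed[OF x, of t]] d2(2)[OF scale_closed[OF x, of t]] by linarith
    moreover have "\<bar>f (vscale V t x) - g (vscale V t x)\<bar> = t * \<bar>f x - g x\<bar>"
      using t by (simp add: scale abs_mult flip: right_diff_distrib)
    moreover have "2 * (c * vnorm V (vscale V t x)) = t * (2 * c * vnorm V x)"
      using t x by (simp add: norm_scale)
    ultimately have "t * \<bar>f x - g x\<bar> \<le> t * (2 * c * vnorm V x)" by simp
    then have "\<bar>f x - g x\<bar> \<le> 2 * c * vnorm V x" using t by simp
    also have "\<dots> \<le> 2 * c * N" using c N by simp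
    also have "\<dots> = e" using N by (simp add: c_def)
    finally show ?thesis by simp
  qed
  then have "\<bar>f x - g x\<bar> \<le> 0" by (rule field_le_epsilon)
  then show "f x = g x" by simp
qed

lemma frechet_eq: "has_frechet_derivative V I f u \<Longrightarrow> frechet V I u = f"
  unfolding frechet_def by (blast intro: has_frechet_derivative_unique)

end

end

theory Submission
  imports Defs "HOL-Homology.Invariance_of_Domain"
begin

text \<open>
  The space is the Hilbert space of square-summable sequences and the functional is
  \<open>I(u) = - \<langle>Au, u\<rangle> / (1 + \<rho>\<^sup>2)\<close> with \<open>\<rho> = \<parallel>u\<parallel>\<^sup>2\<close>, where \<open>A\<close> multiplies the \<open>i\<close>-th coordinate
  by \<open>1/(i + 1)\<close>. Along a ray, \<open>\<langle>Au, u\<rangle>\<close> is proportional to \<open>\<rho>\<close>, and \<open>\<rho> / (1 + \<rho>\<^sup>2)\<close> has its only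
  critical point in \<open>\<rho> > 0\<close> at \<open>\<rho> = 1\<close>. So every critical point other than \<open>0\<close> lies on the unit
  sphere (\<open>norm_critical_point\<close>), although the critical values \<open>- 1/(2(i + 1))\<close>, attained at the
  unit vectors, tend to \<open>0\<close>. Since \<open>I\<close> vanishes only at \<open>0\<close>, the set \<open>K\<^sub>0\<close> is \<open>{0}\<close>, and all critical
  points of negative value have distance \<open>1\<close> from it.

  For (A2), the gradient is \<open>- 2/(1 + \<rho>\<^sup>2) (Au - \<kappa>u)\<close> with \<open>\<kappa> = - 2\<rho> I(u)\<close>. Along a Palais-Smale
  sequence at a negative level \<open>\<rho>\<close> stays bounded and \<open>\<kappa>\<close> accumulates at some \<open>\<kappa>\<^sub>0 > 0\<close>. As the
  eigenvalues of \<open>A\<close> are simple and accumulate only at \<open>0\<close>, the operator \<open>A - \<kappa>\<^sub>0\<close> is bounded below off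
  a single coordinate, which forces a convergent subsequence (\<open>palais_smale_energy\<close>).

  For (A3), the unit sphere in the span of the first \<open>n + 1\<close> unit vectors has \<open>I \<le> - 1/(2(n + 1))\<close>,
  and its genus is at least \<open>n + 1\<close> by the Borsuk-Ulam theorem (\<open>Borsuk_Ulam_nsphere\<close>). The latter
  follows from the fact that odd self-maps of spheres have odd degree (\<open>odd_degree_of_odd_map\<close>),
  proved by induction on the dimension. The library theorem \<open>Borsuk_odd_mapping_degree_step\<close> gives
  the induction step for odd maps preserving the equator. A general odd map is first replaced by an
  odd Lipschitz map; the image of the equator then is too small to meet every line through the origin
  (\<open>nsphere_lipschitz_avoids_line\<close>), and after a linear shear the map can be deformed to preserve
  the equator.

  The Hilbert space is built as a type, so that the calculus of the library applies, and is then
  carried over to the set of square-summable functions by \<open>nvs_of\<close>.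
\<close>

section \<open>Lipschitz maps on spheres\<close>

lemma topspace_nsphere: "topspace (nsphere n) = {x. (\<Sum>i\<le>n. (x i)\<^sup>2) = 1 \<and> (\<forall>i>n. x i = 0)}"
  by (simp add: nsphere)

lemma nsphere_abs_le_1:
  assumes "x \<in> topspace (nsphere n)"
  shows "\<bar>x i\<bar> \<le> 1"
proof (cases "i \<le> n")
  case True
  have "(x i)\<^sup>2 \<le> (\<Sum>i\<le>n. (x i)\<^sup>2)"
    using True by (intro member_le_sum) auto
  with assms show ?thesis
    by (simp add: topspace_nsphere abs_square_le_1)
qed (use assms in \<open>simp add: topspace_nsphere\<close>)

lemma nsphere_large_coordinate:
  assumes "x \<in> topspace (nsphere n)"
  shows "\<exists>i\<le>n. 1 / (real n + 1) \<le> \<bar>x i\<bar>"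
proof (rule ccontr)
  assume neg: "\<not> (\<exists>i\<le>n. 1 / (real n + 1) \<le> \<bar>x i\<bar>)"
  have "(x i)\<^sup>2 < 1 / (real n + 1)" if "i \<le> n" for i
  proof -
    have lt: "\<bar>x i\<bar> < 1 / (real n + 1)"
      using neg that not_le by blast
    have "(x i)\<^sup>2 = \<bar>x i\<bar> * \<bar>x i\<bar>"
      by (simp add: power2_eq_square)
    also have "\<dots> \<le> \<bar>x i\<bar> * 1"
      by (intro mult_left_mono nsphere_abs_le_1[OF assms]) simp
    finally show ?thesis
      using lt by simp
  qed
  then have "(\<Sum>i\<le>n. (x i)\<^sup>2) < (\<Sum>i\<le>n. 1 / (real n + 1))"
    by (intro sum_strict_mono) auto
  then show False
    using assms by (simp add: topspace_nsphere)
qed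

text \<open>
  On a part of the sphere where the coordinate \<open>i\<close> has constant sign and is bounded away from \<open>0\<close>,
  the other \<open>n\<close> coordinates form a chart whose inverse is Lipschitz, because
  \<open>x\<^sub>i\<^sup>2 = 1 - \<Sum>\<^bsub>j \<noteq> i\<^esub> x\<^sub>j\<^sup>2\<close>.
\<close>

lemma nsphere_same_cell:
  assumes x: "x \<in> topspace (nsphere n)" and y: "y \<in> topspace (nsphere n)"
    and i: "i \<le> n" "1 / (real n + 1) \<le> \<bar>x i\<bar>" "1 / (real n + 1) \<le> \<bar>y i\<bar>"
    and sgn: "0 \<le> x i \<longleftrightarrow> 0 \<le> y i"
    and near: "\<And>j. j \<le> n \<Longrightarrow> j \<noteq> i \<Longrightarrow> \<bar>x j - y j\<bar> \<le> e"
  shows "(\<Sum>j\<le>n. \<bar>x j - y j\<bar>) \<le> real n * (real n + 2) * e"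
proof -
  let ?J = "{..n} - {i}"
  have J: "card ?J = n" using i by simp
  have split: "(\<Sum>j\<le>n. f j) = f i + sum f ?J" for f :: "nat \<Rightarrow> real"
    using i by (simp add: sum.remove)
  have "(x i)\<^sup>2 - (y i)\<^sup>2 = (\<Sum>j\<in>?J. (y j)\<^sup>2 - (x j)\<^sup>2)"
    using x y split[of "\<lambda>j. (x j)\<^sup>2"] split[of "\<lambda>j. (y j)\<^sup>2"]
    by (simp add: topspace_nsphere sum_subtractf)
  then have "\<bar>(x i)\<^sup>2 - (y i)\<^sup>2\<bar> \<le> (\<Sum>j\<in>?J. \<bar>(y j)\<^sup>2 - (x j)\<^sup>2\<bar>)"
    by (simp add: sum_abs)
  also have "\<dots> \<le> (\<Sum>j\<in>?J. 2 * e)"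
  proof (rule sum_mono)
    fix j assume j: "j \<in> ?J"
    have "\<bar>(y j)\<^sup>2 - (x j)\<^sup>2\<bar> = \<bar>y j + x j\<bar> * \<bar>x j - y j\<bar>"
      by (simp add: power2_eq_square square_diff_square_factored abs_mult abs_minus_commute)
    also have "\<dots> \<le> 2 * e"
      using j near[of j] nsphere_abs_le_1[OF x, of j] nsphere_abs_le_1[OF y, of j]
      by (intro mult_mono) auto
    finally show "\<bar>(y j)\<^sup>2 - (x j)\<^sup>2\<bar> \<le> 2 * e" .
  qed
  finally have A: "\<bar>(x i)\<^sup>2 - (y i)\<^sup>2\<bar> \<le> 2 * real n * e"
    by (simp add: J)
  have "2 / (real n + 1) * \<bar>x i - y i\<bar> \<le> \<bar>x i + y i\<bar> * \<bar>x i - y i\<bar>"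
    using i sgn by (intro mult_right_mono) (auto simp: abs_if split: if_splits)
  also have "\<dots> = \<bar>(x i)\<^sup>2 - (y i)\<^sup>2\<bar>"
    by (simp add: power2_eq_square square_diff_square_factored abs_mult)
  finally have "2 / (real n + 1) * \<bar>x i - y i\<bar> \<le> 2 * real n * e"
    using A by linarith
  then have "\<bar>x i - y i\<bar> \<le> real n * (real n + 1) * e"
    by (simp add: field_simps)
  moreover have "(\<Sum>j\<in>?J. \<bar>x j - y j\<bar>) \<le> real n * e"
    using sum_bounded_above[of ?J "\<lambda>j. \<bar>x j - y j\<bar>" e] near J by auto
  ultimately show ?thesis
    using split[of "\<lambda>j. \<bar>x j - y j\<bar>"] by (simp add: algebra_simps)
qed

text \<open>
  This is where the dimension of the sphere enters: it is covered by \<open>O(K\<^sup>n)\<close> cells of size \<open>O(1/K)\<close>.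
  A cell is given by the index and sign of a large coordinate and by the other \<open>n\<close> coordinates,
  rounded down to multiples of \<open>1/K\<close>.
\<close>

lemma nsphere_separated_card_le:
  fixes x :: "'t \<Rightarrow> nat \<Rightarrow> real"
  assumes K: "K \<ge> 1" 
    and x: "\<And>t. t \<in> T \<Longrightarrow> x t \<in> topspace (nsphere n)"
    and sep: "\<And>s t. s \<in> T \<Longrightarrow> t \<in> T \<Longrightarrow> s \<noteq> t \<Longrightarrow>
        (\<Sum>j\<le>n. \<bar>x s j - x t j\<bar>) > real n * (real n + 2) / real K"
  shows "card T \<le> (n + 1) * (2 * (2 * K + 1) ^ n)"
proof -
  define big where "big t = (SOME i. i \<le> n \<and> 1 / (real n + 1) \<le> \<bar>x t i\<bar>)" for t
  have big: "big t \<le> n \<and> 1 / (real n + 1) \<le> \<bar>x t (big t)\<bar>" if "t \<in> T" for t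
    unfolding big_def by (rule someI_ex) (use nsphere_large_coordinate[OF x[OF that]] in blast)
  define cell where "cell t =
     (big t, 0 \<le> x t (big t), restrict (\<lambda>j. \<lfloor>real K * x t j\<rfloor>) ({..n} - {big t}))" for t
  let ?C = "SIGMA i:{..n}. (UNIV :: bool set) \<times> (({..n} - {i}) \<rightarrow>\<^sub>E {- int K..int K})"
  have "\<lfloor>real K * x t j\<rfloor> \<in> {- int K..int K}" if "t \<in> T" for t j
  proof -
    have "\<bar>real K * x t j\<bar> \<le> real K * 1"
      unfolding abs_mult abs_of_nat
      by (intro mult_left_mono nsphere_abs_le_1[OF x[OF that]]) simp
    then show ?thesis
      by (auto simp: le_floor_iff floor_le_iff)
  qed
  then have sub: "cell ` T \<subseteq> ?C"
    using big by (force simp: cell_def PiE_iff extensional_def)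
  have inj: "inj_on cell T"
  proof (rule inj_onI, rule ccontr)
    fix s t assume st: "s \<in> T" "t \<in> T" "cell s = cell t" "s \<noteq> t"
    then have b: "big s = big t" by (simp add: cell_def)
    have "\<bar>x s j - x t j\<bar> \<le> 1 / real K" if j: "j \<le> n" "j \<noteq> big t" for j
    proof -
      have "restrict (\<lambda>j. \<lfloor>real K * x s j\<rfloor>) ({..n} - {big t}) j
          = restrict (\<lambda>j. \<lfloor>real K * x t j\<rfloor>) ({..n} - {big t}) j"
        using st b by (auto simp: cell_def)
      then have "\<lfloor>real K * x s j\<rfloor> = \<lfloor>real K * x t j\<rfloor>"
        using j by simp
      then have "\<bar>real K * x s j - real K * x t j\<bar> \<le> 1"
        by linarith
      then have "real K * \<bar>x s j - x t j\<bar> \<le> 1"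
        by (simp add: abs_mult flip: right_diff_distrib)
      then show ?thesis
        using K by (simp add: field_simps)
    qed
    then have "(\<Sum>j\<le>n. \<bar>x s j - x t j\<bar>) \<le> real n * (real n + 2) * (1 / real K)"
      using st b big[of s] big[of t]
      by (intro nsphere_same_cell[where i = "big t"] x) (auto simp: cell_def)
    with sep st show False by fastforce
  qed
  have fin: "finite ?C"
    by (intro finite_SigmaI finite_PiE finite_cartesian_product) auto
  have "card T = card (cell ` T)"
    by (simp add: card_image inj)
  also have "\<dots> \<le> card ?C"
    by (intro card_mono fin sub)
  also have "\<dots> = (n + 1) * (2 * (2 * K + 1) ^ n)"
  proof -
    have "card ((UNIV :: bool set) \<times> (({..n} - {i}) \<rightarrow>\<^sub>E {- int K..int K})) = 2 * (2 * K + 1) ^ n"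
      if "i \<le> n" for i
      using that by (simp add: card_cartesian_product card_PiE nat_add_distrib nat_mult_distrib)
    then show ?thesis
      by (subst card_SigmaI) (auto intro!: finite_PiE finite_cartesian_product)
  qed
  finally show ?thesis .
qed

text \<open>
  A dimension count without measure theory. If \<open>p\<close> met every line spanned by some \<open>(c, 1)\<close>, it would
  meet the lines for all \<open>(M + 1)\<^bsup>n + 1\<^esup>\<close> grid points \<open>c \<in> {0, 1/M, \<dots>, 1}\<^bsup>n + 1\<^esup>\<close>. Since \<open>p\<close> is Lipschitz
  and bounded away from \<open>0\<close>, the corresponding points of the sphere would be separated by some fixed
  multiple of \<open>1/M\<close>, but the \<open>n\<close>-sphere has room for only \<open>O(M\<^sup>n)\<close> such points.
\<close>

lemma nsphere_lipschitz_avoids_line: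
  fixes p :: "nat \<Rightarrow> (nat \<Rightarrow> real) \<Rightarrow> real"
  assumes L: "L > 0" and mu: "\<mu> > 0"
    and Lip: "\<And>i x y. i \<le> Suc n \<Longrightarrow> x \<in> topspace (nsphere n) \<Longrightarrow> y \<in> topspace (nsphere n) \<Longrightarrow>
        \<bar>p i x - p i y\<bar> \<le> L * (\<Sum>j\<le>n. \<bar>x j - y j\<bar>)"
    and nz: "\<And>x. x \<in> topspace (nsphere n) \<Longrightarrow> \<exists>i\<le>Suc n. \<mu> \<le> \<bar>p i x\<bar>"
  obtains c where "\<And>x. x \<in> topspace (nsphere n) \<Longrightarrow> \<exists>i\<le>n. p i x \<noteq> c i * p (Suc n) x"
proof (rule ccontr)
  assume "\<not> thesis"
  then have "\<forall>c. \<exists>x\<in>topspace (nsphere n). \<forall>i\<le>n. p i x = c i * p (Suc n) x"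
    using that by blast
  then obtain X where X: "\<And>c :: nat \<Rightarrow> real. X c \<in> topspace (nsphere n)"
      "\<And>c i. i \<le> n \<Longrightarrow> p i (X c) = c i * p (Suc n) (X c)"
    by metis
  define C where "C = real n * (real n + 2)"
  obtain B :: nat where B: "real B > 2 * L * C / \<mu> + 1"
    using reals_Archimedean2 by blast
  have C0: "C \<ge> 0" by (simp add: C_def)
  then have "2 * L * C / \<mu> \<ge> 0" using L mu by simp
  then have "real B > 1" and B2: "2 * L * C < \<mu> * real B"
    using B mu by (linarith, auto simp: field_simps)
  then have B1: "B \<ge> 1" by simp
  \<comment> \<open>Cells of width \<open>1/(BM)\<close> contain at most one of the points; \<open>M\<close> makes \<open>(M + 1)\<^bsup>n + 1\<^esup>\<close> exceed their number.\<close>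
  define M where "M = 2 * (n + 1) * (3 * B) ^ n"
  have "M > 0" using B1 by (simp add: M_def)
  then have M1: "M \<ge> 1" by simp
  let ?T = "{..n} \<rightarrow>\<^sub>E {0..M}"
  define x where "x t = X (\<lambda>i. real (t i) / real M)" for t :: "nat \<Rightarrow> nat"
  have x: "x t \<in> topspace (nsphere n)" for t
    by (simp add: x_def X(1))
  have px: "p i (x t) = real (t i) / real M * p (Suc n) (x t)" if "i \<le> n" for i t
    unfolding x_def by (rule X(2)[OF that])
  have t1: "\<bar>real (t i) / real M\<bar> \<le> 1" if "t \<in> ?T" "i \<le> n" for t i
    using that M1 by (auto simp: PiE_iff)
  \<comment> \<open>The slopes \<open>t i / M\<close> are at most 1, so the last component dominates the others.\<close>
  have last: "\<mu> \<le> \<bar>p (Suc n) (x t)\<bar>" if t: "t \<in> ?T" for t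
  proof -
    obtain i where i: "i \<le> Suc n" "\<mu> \<le> \<bar>p i (x t)\<bar>"
      using nz[OF x] by blast
    show ?thesis
    proof (cases "i = Suc n")
      case False
      then have "\<bar>p i (x t)\<bar> = \<bar>real (t i) / real M\<bar> * \<bar>p (Suc n) (x t)\<bar>"
        using i px[of i t] by (simp add: abs_mult)
      also have "\<dots> \<le> 1 * \<bar>p (Suc n) (x t)\<bar>"
        using False i t by (intro mult_right_mono t1) auto
      finally show ?thesis using i by simp
    qed (use i in simp)
  qed
  have "card ?T \<le> (n + 1) * (2 * (2 * (B * M) + 1) ^ n)"
  proof (rule nsphere_separated_card_le[where x = x])
    fix s t assume st: "s \<in> ?T" "t \<in> ?T" "s \<noteq> t"
    then obtain i where i: "i \<le> n" "s i \<noteq> t i"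
      by (metis PiE_ext atMost_iff)
    define D where "D = (\<Sum>j\<le>n. \<bar>x s j - x t j\<bar>)"
    let ?a = "p (Suc n)"
    have "\<mu> / real M \<le> \<bar>?a (x s)\<bar> * (\<bar>real (s i) - real (t i)\<bar> / real M)"
    proof -
      have "1 \<le> \<bar>real (s i) - real (t i)\<bar>" using i by linarith
      then have "\<mu> * (1 / real M) \<le> \<bar>?a (x s)\<bar> * (\<bar>real (s i) - real (t i)\<bar> / real M)"
        using last[OF st(1)] mu by (intro mult_mono divide_right_mono) auto
      then show ?thesis by simp
    qed
    also have "\<dots> = \<bar>?a (x s) * (real (s i) / real M) - ?a (x s) * (real (t i) / real M)\<bar>"
      by (simp add: abs_mult flip: right_diff_distrib diff_divide_distrib)
    also have "\<dots> = \<bar>(p i (x s) - p i (x t)) + real (t i) / real M * (?a (x t) - ?a (x s))\<bar>"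
      by (simp add: px i algebra_simps)
    also have "\<dots> \<le> \<bar>p i (x s) - p i (x t)\<bar> + \<bar>real (t i) / real M\<bar> * \<bar>?a (x t) - ?a (x s)\<bar>"
      by (metis abs_mult abs_triangle_ineq)
    also have "\<dots> \<le> L * D + 1 * (L * D)"
    proof (intro add_mono mult_mono)
      show "\<bar>p i (x s) - p i (x t)\<bar> \<le> L * D"
        using i by (simp add: D_def Lip x)
      show "\<bar>?a (x t) - ?a (x s)\<bar> \<le> L * D"
        using Lip[of "Suc n" "x s" "x t"] by (simp add: D_def x abs_minus_commute)
    qed (use t1 st i in auto)
    finally have "\<mu> / real M \<le> 2 * L * D" by (simp add: mult_ac)
    then have "\<mu> * real B \<le> 2 * L * D * real (B * M)"
      using M1 B1 by (simp add: field_simps)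
    then have "2 * L * C < 2 * L * (D * real (B * M))"
      using B2 by (simp add: mult.assoc)
    then have "C < D * real (B * M)"
      using L by simp
    then show "(\<Sum>j\<le>n. \<bar>x s j - x t j\<bar>) > real n * (real n + 2) / real (B * M)"
      using M1 B1 by (simp add: C_def D_def field_simps)
  qed (use x B1 M1 in auto)
  also have "card ?T = (M + 1) ^ Suc n"
    by (simp add: card_PiE)
  also have "(n + 1) * (2 * (2 * (B * M) + 1) ^ n) \<le> (n + 1) * (2 * (3 * (B * M)) ^ n)"
    using B1 M1 by (intro mult_le_mono power_mono) auto
  also have "\<dots> = 2 * (n + 1) * (3 * B) ^ n * M ^ n"
    by (simp only: power_mult_distrib mult_ac)
  also have "\<dots> = M * M ^ n"
    by (simp only: M_def)
  also have "\<dots> < (M + 1) ^ Suc n"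
    by (metis Suc_eq_plus1 lessI power_Suc power_strict_mono zero_le zero_less_Suc)
  finally show False by simp
qed

lemma nsphere_top_of_set: "nsphere n = top_of_set (topspace (nsphere n))"
  by (simp add: nsphere euclidean_product_topology)

lemma compact_topspace_nsphere: "compact (topspace (nsphere n))"
proof -
  have "compactin (powertop_real UNIV) (PiE UNIV (\<lambda>i::nat. {- 1..1}))"
    by (subst compactin_PiE) auto
  then have "compact (PiE UNIV (\<lambda>i::nat. {- 1..1::real}))"
    by (simp add: euclidean_product_topology)
  moreover have "closed (topspace (nsphere n))"
    unfolding topspace_nsphere
    by (intro closed_Collect_conj closed_Collect_all closed_Collect_imp closed_Collect_eq
        continuous_intros open_Collect_const continuous_on_product_coordinates)
  moreover have "topspace (nsphere n) \<subseteq> PiE UNIV (\<lambda>i::nat. {- 1..1::real})"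
    using nsphere_abs_le_1 by (fastforce simp: abs_le_iff)
  ultimately show ?thesis
    by (metis closed_Int_compact inf.absorb1)
qed

lemma uminus_in_nsphere:
  "x \<in> topspace (nsphere n) \<Longrightarrow> (\<lambda>i. - x i) \<in> topspace (nsphere n)"
  by (simp add: topspace_nsphere)

lemma lipschitz_continuous_nsphere:
  fixes g :: "(nat \<Rightarrow> real) \<Rightarrow> real"
  assumes L: "\<And>x y. x \<in> topspace (nsphere n) \<Longrightarrow> y \<in> topspace (nsphere n) \<Longrightarrow>
        \<bar>g x - g y\<bar> \<le> L * (\<Sum>j\<le>n. \<bar>x j - y j\<bar>)"
  shows "continuous_on (topspace (nsphere n)) g"
  unfolding continuous_on_def
proof
  let ?S = "topspace (nsphere n)" and ?d = "\<lambda>x y. \<Sum>j\<le>n. \<bar>x j - y j\<bar> :: real"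
  fix a assume a: "a \<in> ?S"
  have "continuous_on UNIV (\<lambda>x. L * ?d x a)"
    by (intro continuous_intros continuous_on_product_coordinates)
  then have "((\<lambda>x. L * ?d x a) \<longlongrightarrow> L * ?d a a) (at a within ?S)"
    by (meson UNIV_I continuous_on_def subset_UNIV tendsto_within_subset)
  then have "((\<lambda>x. L * ?d x a) \<longlongrightarrow> 0) (at a within ?S)"
    by simp
  moreover have "\<forall>\<^sub>F x in at a within ?S. norm (g x - g a) \<le> L * ?d x a"
    using L a by (simp add: eventually_at_filter)
  ultimately have "((\<lambda>x. g x - g a) \<longlongrightarrow> 0) (at a within ?S)"
    by (rule Lim_null_comparison[rotated])
  then show "(g \<longlongrightarrow> g a) (at a within ?S)"
    by (rule LIM_zero_cancel)
qed

text \<open>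
  The Lipschitz functions form a point-separating algebra on the compact sphere, so the
  Stone-Weierstrass theorem applies.
\<close>

lemma nsphere_lipschitz_approximation:
  fixes f :: "(nat \<Rightarrow> real) \<Rightarrow> real"
  assumes f: "continuous_on (topspace (nsphere n)) f" and e: "e > 0"
  obtains g L where 
    "\<And>x y. x \<in> topspace (nsphere n) \<Longrightarrow> y \<in> topspace (nsphere n) \<Longrightarrow>
        \<bar>g x - g y\<bar> \<le> L * (\<Sum>j\<le>n. \<bar>x j - y j\<bar>)"
    "\<And>x. x \<in> topspace (nsphere n) \<Longrightarrow> \<bar>f x - g x\<bar> < e"
proof -
  let ?S = "topspace (nsphere n)"
  define d where "d x y = (\<Sum>j\<le>n. \<bar>x j - y j\<bar>)" for x y :: "nat \<Rightarrow> real"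
  define lip where "lip g \<longleftrightarrow> (\<exists>L\<ge>0. \<forall>x\<in>?S. \<forall>y\<in>?S. \<bar>g x - g y\<bar> \<le> L * d x y)" 
    for g :: "(nat \<Rightarrow> real) \<Rightarrow> real"
  have d0: "0 \<le> d x y" for x y by (simp add: d_def sum_nonneg)
  have dle: "d x y \<le> 2 * (real n + 1)" if "x \<in> ?S" "y \<in> ?S" for x y
  proof -
    have "d x y \<le> (\<Sum>j\<le>n. 2)"
      unfolding d_def
    proof (rule sum_mono)
      fix j show "\<bar>x j - y j\<bar> \<le> 2"
        using nsphere_abs_le_1[OF that(1), of j] nsphere_abs_le_1[OF that(2), of j] by linarith
    qed
    then show ?thesis by simp
  qed
  have bounded: "\<exists>B\<ge>0. \<forall>x\<in>?S. \<bar>g x\<bar> \<le> B" if "lip g" for g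
  proof -
    obtain L where L: "L \<ge> 0" "\<And>x y. x \<in> ?S \<Longrightarrow> y \<in> ?S \<Longrightarrow> \<bar>g x - g y\<bar> \<le> L * d x y"
      using \<open>lip g\<close> unfolding lip_def by blast
    obtain a where a: "a \<in> ?S" using in_topspace_nsphere by blast
    have "\<bar>g x\<bar> \<le> \<bar>g a\<bar> + L * (2 * (real n + 1))" if "x \<in> ?S" for x
      using L(2)[OF that a] mult_left_mono[OF dle[OF that a] L(1)] by linarith
    moreover have "0 \<le> \<bar>g a\<bar> + L * (2 * (real n + 1))" using L by simp
    ultimately show ?thesis by blast
  qed
  have "\<exists>g. lip g \<and> (\<forall>x\<in>?S. \<bar>f x - g x\<bar> < e)"
  proof (rule Stone_Weierstrass_HOL[where P = lip])
    show "lip (\<lambda>x. c)" for c :: real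
      by (auto simp: lip_def d0 intro!: exI[of _ 0])
    show "continuous_on ?S g" if "lip g" for g
    proof -
      obtain L where L: "L \<ge> 0" "\<And>x y. x \<in> ?S \<Longrightarrow> y \<in> ?S \<Longrightarrow> \<bar>g x - g y\<bar> \<le> L * d x y"
        using \<open>lip g\<close> unfolding lip_def by blast
      then show ?thesis
        unfolding d_def by (intro lipschitz_continuous_nsphere)
    qed
    show "lip (\<lambda>x. g x + h x)" if lips: "lip g \<and> lip h" for g h
    proof -
      obtain L M where LM: "L \<ge> 0" "\<And>x y. x \<in> ?S \<Longrightarrow> y \<in> ?S \<Longrightarrow> \<bar>g x - g y\<bar> \<le> L * d x y"
         "M \<ge> 0" "\<And>x y. x \<in> ?S \<Longrightarrow> y \<in> ?S \<Longrightarrow> \<bar>h x - h y\<bar> \<le> M * d x y"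
        using lips unfolding lip_def by blast
      have "\<bar>g x + h x - (g y + h y)\<bar> \<le> (L + M) * d x y" if "x \<in> ?S" "y \<in> ?S" for x y
        using LM(2,4)[OF that] by (simp add: algebra_simps)
      then show ?thesis
        unfolding lip_def using LM by (intro exI[of _ "L + M"]) auto
    qed
    show "lip (\<lambda>x. g x * h x)" if lips: "lip g \<and> lip h" for g h
    proof -
      obtain L M where LM: "L \<ge> 0" "\<And>x y. x \<in> ?S \<Longrightarrow> y \<in> ?S \<Longrightarrow> \<bar>g x - g y\<bar> \<le> L * d x y"
         "M \<ge> 0" "\<And>x y. x \<in> ?S \<Longrightarrow> y \<in> ?S \<Longrightarrow> \<bar>h x - h y\<bar> \<le> M * d x y"
        using lips unfolding lip_def by blast
      obtain A where A: "A \<ge> 0" "\<And>x. x \<in> ?S \<Longrightarrow> \<bar>g x\<bar> \<le> A"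
        using lips bounded[of g] by blast
      obtain B where B: "B \<ge> 0" "\<And>x. x \<in> ?S \<Longrightarrow> \<bar>h x\<bar> \<le> B"
        using lips bounded[of h] by blast
      note AB = A B
      have "\<bar>g x * h x - g y * h y\<bar> \<le> (A * M + B * L) * d x y" if "x \<in> ?S" "y \<in> ?S" for x y
      proof -
        have "g x * h x - g y * h y = g x * (h x - h y) + h y * (g x - g y)"
          by (simp add: algebra_simps)
        then have "\<bar>g x * h x - g y * h y\<bar> \<le> \<bar>g x\<bar> * \<bar>h x - h y\<bar> + \<bar>h y\<bar> * \<bar>g x - g y\<bar>"
          by (metis abs_mult abs_triangle_ineq)
        also have "\<dots> \<le> A * (M * d x y) + B * (L * d x y)"
          using LM AB that by (intro add_mono mult_mono) auto
        finally show ?thesis by (simp add: algebra_simps)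
      qed
      then show ?thesis
        unfolding lip_def using LM AB by (intro exI[of _ "A * M + B * L"]) auto
    qed
    show "\<exists>g. lip g \<and> g x \<noteq> g y" if xy: "x \<in> ?S \<and> y \<in> ?S \<and> x \<noteq> y" for x y
    proof -
      obtain i where i: "x i \<noteq> y i" using xy by blast
      then have "i \<le> n" using xy by (auto simp: topspace_nsphere not_less[symmetric])
      then have "\<bar>u i - v i\<bar> \<le> 1 * d u v" for u v :: "nat \<Rightarrow> real"
        unfolding d_def mult_1 by (intro member_le_sum) auto
      then have "lip (\<lambda>u. u i)" 
        unfolding lip_def by (intro exI[of _ 1]) auto
      with i show ?thesis by blast
    qed
  qed (use f e compact_topspace_nsphere in auto)
  then show thesis
    using that unfolding lip_def d_def by blast
qed

text \<open>
  Replacing an approximation by its odd part does not increase the distance to an odd function.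
\<close>

lemma nsphere_odd_lipschitz_approximation:
  fixes f :: "(nat \<Rightarrow> real) \<Rightarrow> nat \<Rightarrow> real"
  assumes f: "\<And>i. continuous_on (topspace (nsphere n)) (\<lambda>x. f x i)" and e: "e > 0"
    and odd: "\<And>x. x \<in> topspace (nsphere n) \<Longrightarrow> f (\<lambda>i. - x i) = (\<lambda>i. - f x i)"
  obtains p L where "L > 0"
    "\<And>i x y. i \<le> n \<Longrightarrow> x \<in> topspace (nsphere n) \<Longrightarrow> y \<in> topspace (nsphere n) \<Longrightarrow>
        \<bar>p i x - p i y\<bar> \<le> L * (\<Sum>j\<le>n. \<bar>x j - y j\<bar>)"
    "\<And>i x. i \<le> n \<Longrightarrow> x \<in> topspace (nsphere n) \<Longrightarrow> \<bar>f x i - p i x\<bar> < e"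
    "\<And>i x. p i (\<lambda>i. - x i) = - p i x"
proof -
  let ?S = "topspace (nsphere n)"
  have "\<exists>g L. (\<forall>x\<in>?S. \<forall>y\<in>?S. \<bar>g x - g y\<bar> \<le> L * (\<Sum>j\<le>n. \<bar>x j - y j\<bar>)) \<and> (\<forall>x\<in>?S. \<bar>f x i - g x\<bar> < e)" for i
    by (rule nsphere_lipschitz_approximation[OF f[of i] e]) blast
  then have "\<forall>i. \<exists>g L. (\<forall>x\<in>?S. \<forall>y\<in>?S. \<bar>g x - g y\<bar> \<le> L * (\<Sum>j\<le>n. \<bar>x j - y j\<bar>)) \<and> (\<forall>x\<in>?S. \<bar>f x i - g x\<bar> < e)"
    by blast
  from choice[OF this] obtain g where "\<forall>i. \<exists>L. (\<forall>x\<in>?S. \<forall>y\<in>?S. \<bar>g i x - g i y\<bar> \<le> L * (\<Sum>j\<le>n. \<bar>x j - y j\<bar>)) \<and> (\<forall>x\<in>?S. \<bar>f x i - g i x\<bar> < e)"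
    by blast
  from choice[OF this] obtain L where g: 
      "\<And>i x y. x \<in> ?S \<Longrightarrow> y \<in> ?S \<Longrightarrow> \<bar>g i x - g i y\<bar> \<le> L i * (\<Sum>j\<le>n. \<bar>x j - y j\<bar>)"
      "\<And>i x. x \<in> ?S \<Longrightarrow> \<bar>f x i - g i x\<bar> < e"
    by blast
  define p where "p i x = (g i x - g i (\<lambda>j. - x j)) / 2" for i and x :: "nat \<Rightarrow> real"
  define K where "K = 1 + (\<Sum>i\<le>n. \<bar>L i\<bar>)"
  show thesis
  proof
    show "K > 0" by (simp add: K_def sum_nonneg add_pos_nonneg)
    show "p i (\<lambda>i. - x i) = - p i x" for i x
      by (simp add: p_def field_simps)
    fix i and x :: "nat \<Rightarrow> real" assume i: "i \<le> n" and x: "x \<in> ?S"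
    show "\<bar>f x i - p i x\<bar> < e"
      using g(2)[OF x, of i] g(2)[OF uminus_in_nsphere[OF x], of i] odd[OF x]
      by (simp add: p_def abs_if field_simps split: if_splits)
    fix y :: "nat \<Rightarrow> real" assume y: "y \<in> ?S"
    let ?d = "\<Sum>j\<le>n. \<bar>x j - y j\<bar>"
    have eq: "(\<Sum>j\<le>n. \<bar>- x j - - y j\<bar>) = ?d"
      by (intro sum.cong) auto
    have "\<bar>p i x - p i y\<bar> \<le> L i * ?d"
      using g(1)[OF x y, of i] g(1)[OF uminus_in_nsphere[OF x] uminus_in_nsphere[OF y], of i]
      unfolding eq by (simp add: p_def abs_if field_simps split: if_splits)
    also have "\<dots> \<le> K * ?d"
    proof (intro mult_right_mono sum_nonneg)
      have "\<bar>L i\<bar> \<le> (\<Sum>i\<le>n. \<bar>L i\<bar>)" using i by (intro member_le_sum) auto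
      then show "L i \<le> K" by (simp add: K_def)
    qed auto
    finally show "\<bar>p i x - p i y\<bar> \<le> K * ?d" .
  qed
qed

definition sphere_proj :: "nat \<Rightarrow> (nat \<Rightarrow> real) \<Rightarrow> nat \<Rightarrow> real" where
  "sphere_proj n v = (\<lambda>i. v i / sqrt (\<Sum>j\<le>n. (v j)\<^sup>2))"

lemma sphere_proj_uminus: "sphere_proj n (\<lambda>i. - v i) = (\<lambda>i. - sphere_proj n v i)"
  by (simp add: sphere_proj_def)

lemma sphere_proj_nsphere: "v \<in> topspace (nsphere n) \<Longrightarrow> sphere_proj n v = v"
  by (simp add: sphere_proj_def topspace_nsphere)

lemma continuous_map_sphere_proj:
  assumes F: "\<And>i. continuous_map X euclideanreal (\<lambda>x. F x i)"
    and nz: "\<And>x. x \<in> topspace X \<Longrightarrow> \<exists>i\<le>n. F x i \<noteq> 0"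
    and zero: "\<And>x i. x \<in> topspace X \<Longrightarrow> n < i \<Longrightarrow> F x i = 0"
  shows "continuous_map X (nsphere n) (\<lambda>x. sphere_proj n (F x))"
proof -
  have pos: "(\<Sum>j\<le>n. (F x j)\<^sup>2) > 0" if "x \<in> topspace X" for x
    using nz[OF that] by (metis atMost_iff finite_atMost sum_pos2 zero_le_power2 zero_less_power2)
  have "continuous_map X euclideanreal (\<lambda>x. sphere_proj n (F x) i)" for i
    unfolding sphere_proj_def
    by (intro continuous_map_real_divide continuous_map_sqrt continuous_map_sum
        continuous_map_real_pow F) (use pos in \<open>force+\<close>)
  moreover have "sphere_proj n (F x) \<in> topspace (nsphere n)" if "x \<in> topspace X" for x
    using pos[OF that] zero[OF that]
    by (simp add: topspace_nsphere sphere_proj_def power_divide sum_nonneg flip: sum_divide_distrib)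
  ultimately show ?thesis
    unfolding nsphere by (auto simp: continuous_map_in_subtopology continuous_map_componentwise_UNIV topspace_nsphere)
qed

lemma homotopic_sphere_proj:
  fixes F :: "real \<Rightarrow> 'a \<Rightarrow> nat \<Rightarrow> real"
  assumes F: "\<And>i. continuous_map (prod_topology (top_of_set {0..1}) X) euclideanreal (\<lambda>z. F (fst z) (snd z) i)"
    and nz: "\<And>t x. t \<in> {0..1} \<Longrightarrow> x \<in> topspace X \<Longrightarrow> \<exists>i\<le>n. F t x i \<noteq> 0"
    and zero: "\<And>t x i. t \<in> {0..1} \<Longrightarrow> x \<in> topspace X \<Longrightarrow> n < i \<Longrightarrow> F t x i = 0"
  shows "homotopic_with (\<lambda>_. True) X (nsphere n) (\<lambda>x. sphere_proj n (F 0 x)) (\<lambda>x. sphere_proj n (F 1 x))"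
proof -
  have "continuous_map (prod_topology (top_of_set {0..1}) X) (nsphere n)
          (\<lambda>z. sphere_proj n (F (fst z) (snd z)))"
    using assms by (intro continuous_map_sphere_proj) auto
  then show ?thesis
    by (subst homotopic_with) (auto intro!: exI[of _ "\<lambda>z. sphere_proj n (F (fst z) (snd z))"])
qed

section \<open>The degree of odd maps and the Borsuk-Ulam theorem\<close>

lemma nsphere_0_cases:
  assumes "x \<in> topspace (nsphere 0)"
  shows "x = (\<lambda>i. if i = 0 then 1 else 0) \<or> x = (\<lambda>i. if i = 0 then - 1 else 0)"
proof -
  have "x 0 = 1 \<or> x 0 = - 1" "\<And>i. i \<noteq> 0 \<Longrightarrow> x i = 0"
    using assms by (auto simp: topspace_nsphere power2_eq_1_iff)
  then show ?thesis by (auto simp: fun_eq_iff)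
qed

text \<open>
  By induction on \<open>n\<close>, the map being deformed through nonvanishing maps in two stages: along
  segments from \<open>f\<close> to an odd Lipschitz approximation \<open>p\<close> (the homotopy \<open>F\<close>), then by shearing \<open>p\<close>
  along \<open>c\<close> while its last component is multiplied by \<open>\<bar>x\<^bsub>n+1\<^esub>\<bar>\<close>
  (the homotopy \<open>G\<close>). The result is still odd since \<open>\<bar>x\<^bsub>n+1\<^esub>\<bar>\<close> is even, and it maps the equator
  \<open>x\<^bsub>n+1\<^esub> = 0\<close> to itself. It does not vanish on the equator exactly when \<open>p\<close> avoids the line through
  \<open>(c, 1)\<close> there.
\<close>

theorem odd_degree_of_odd_map:
  assumes "continuous_map (nsphere n) (nsphere n) f"
    and "\<And>x. x \<in> topspace (nsphere n) \<Longrightarrow> f (\<lambda>i. - x i) = (\<lambda>i. - f x i)"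
  shows "odd (Brouwer_degree2 n f)"
  using assms
proof (induction n arbitrary: f)
  case 0
  let ?e = "\<lambda>i::nat. if i = 0 then 1 else 0 :: real"
  let ?m = "\<lambda>i::nat. if i = 0 then - 1 else 0 :: real"
  have e: "?e \<in> topspace (nsphere 0)" by (rule in_topspace_nsphere)
  have me: "(\<lambda>i. - ?e i) = ?m" "(\<lambda>i. - ?m i) = ?e" by auto
  have fm: "f ?m = (\<lambda>i. - f ?e i)" using "0.prems"(2)[OF e] by (simp add: me)
  have "f ?e \<in> topspace (nsphere 0)"
    using "0.prems"(1) e by (auto simp: continuous_map_def)
  then consider "f ?e = ?e" | "f ?e = ?m" using nsphere_0_cases by blast
  then show ?case
  proof cases
    case 1
    then have "f ?m = ?m" using fm me by simp
    then have "Brouwer_degree2 0 f = Brouwer_degree2 0 id"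
      using 1 nsphere_0_cases by (intro Brouwer_degree2_eq) auto
    then show ?thesis by simp
  next
    case 2
    then have "f ?m = ?e" using fm me by simp
    have "f x = (\<lambda>i. if i = 0 then - x i else x i)" if "x \<in> topspace (nsphere 0)" for x
      using nsphere_0_cases[OF that]
    proof
      assume "x = ?e" then show ?thesis using 2 by auto
    next
      assume "x = ?m" then show ?thesis using \<open>f ?m = ?e\<close> by auto
    qed
    then have "Brouwer_degree2 0 f = Brouwer_degree2 0 (\<lambda>x i. if i = 0 then - x i else x i)"
      by (rule Brouwer_degree2_eq)
    then show ?thesis by (simp add: Brouwer_degree2_reflection)
  qed
next
  case (Suc n)
  let ?S = "topspace (nsphere (Suc n))"
  let ?P = "prod_topology (top_of_set {0..1::real}) (nsphere (Suc n))"
  have fS: "f x \<in> ?S" if "x \<in> ?S" for x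
    using Suc.prems(1) that by (auto simp: continuous_map_def)
  have sub: "topspace (nsphere n) \<subseteq> ?S"
    by (auto simp: topspace_nsphere)
  have fc: "continuous_map (nsphere (Suc n)) euclideanreal (\<lambda>x. f x i)" for i
    using continuous_map_compose[OF Suc.prems(1) continuous_map_nsphere_projection[of "Suc n" i]]
    by (simp add: o_def)
  then have fc': "continuous_on ?S (\<lambda>x. f x i)" for i
    by (subst (asm) nsphere_top_of_set) simp
  obtain p L where L: "L > 0"
    and Lip: "\<And>i x y. i \<le> Suc n \<Longrightarrow> x \<in> ?S \<Longrightarrow> y \<in> ?S \<Longrightarrow>
        \<bar>p i x - p i y\<bar> \<le> L * (\<Sum>j\<le>Suc n. \<bar>x j - y j\<bar>)"
    and fp: "\<And>i x. i \<le> Suc n \<Longrightarrow> x \<in> ?S \<Longrightarrow> \<bar>f x i - p i x\<bar> < 1 / (real n + 3)"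
    and podd: "\<And>i x. p i (\<lambda>i. - x i) = - p i x"
    by (rule nsphere_odd_lipschitz_approximation[of "Suc n" f "1 / (real n + 3)"])
      (use fc' Suc.prems(2) in auto)
  have pc: "continuous_map (nsphere (Suc n)) euclideanreal (p i)" if "i \<le> Suc n" for i
  proof -
    have "continuous_on ?S (p i)"
      by (rule lipschitz_continuous_nsphere) (rule Lip[OF that])
    then show ?thesis by (subst nsphere_top_of_set) simp
  qed
  \<comment> \<open>The tolerance \<open>1/(n + 3)\<close> lies below \<open>1/(n + 2)\<close>, which some component of \<open>f x\<close> reaches:
    so neither \<open>p\<close> nor the segment from \<open>f\<close> to \<open>p\<close> vanishes.\<close>
  have fbig: "\<exists>i\<le>Suc n. 1 / (real n + 2) \<le> \<bar>f x i\<bar>" if "x \<in> ?S" for x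
    using nsphere_large_coordinate[OF fS[OF that]] by (simp add: add.commute)
  have less: "1 / (real n + 3) < 1 / (real n + 2)" by (simp add: field_simps)
  define \<mu> where "\<mu> = 1 / (real n + 2) - 1 / (real n + 3)"
  have mu: "\<mu> > 0" using less by (simp add: \<mu>_def)
  have pbig: "\<exists>i\<le>Suc n. \<mu> \<le> \<bar>p i x\<bar>" if x: "x \<in> ?S" for x
  proof -
    obtain i where i: "i \<le> Suc n" "1 / (real n + 2) \<le> \<bar>f x i\<bar>"
      using fbig[OF x] by blast
    then have "\<mu> \<le> \<bar>p i x\<bar>" using fp[OF i(1) x] by (simp add: \<mu>_def)
    with i show ?thesis by blast
  qed
  obtain c where c: "\<And>x. x \<in> topspace (nsphere n) \<Longrightarrow> \<exists>i\<le>n. p i x \<noteq> c i * p (Suc n) x"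
  proof (rule nsphere_lipschitz_avoids_line[OF L mu, of n p])
    show "\<bar>p i x - p i y\<bar> \<le> L * (\<Sum>j\<le>n. \<bar>x j - y j\<bar>)"
      if "i \<le> Suc n" "x \<in> topspace (nsphere n)" "y \<in> topspace (nsphere n)" for i x y
    proof -
      have "x (Suc n) = 0" "y (Suc n) = 0"
        using that by (auto simp: topspace_nsphere)
      moreover have "x \<in> ?S" "y \<in> ?S"
        using that sub by auto
      ultimately show ?thesis
        using Lip[of i x y] that(1) by simp
    qed
    show "\<exists>i\<le>Suc n. \<mu> \<le> \<bar>p i x\<bar>" if "x \<in> topspace (nsphere n)" for x
      using pbig that sub by blast
  qed blast
  have snd: "continuous_map ?P euclideanreal (\<lambda>z. h (snd z))"
    if "continuous_map (nsphere (Suc n)) euclideanreal h" for h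
    using continuous_map_compose[OF continuous_map_snd that] by (simp add: o_def)
  have fst: "continuous_map ?P euclideanreal fst"
    using continuous_map_fst continuous_map_into_fulltopology by blast

  define F where "F t x i = (if i \<le> Suc n then (1 - t) * f x i + t * p i x else 0)" for t x i
  define G where "G t x i = (if i \<le> n then p i x - t * (c i * p (Suc n) x)
      else if i = Suc n then (1 - t * (1 - \<bar>x (Suc n)\<bar>)) * p (Suc n) x else 0)" for t x i
  define q where "q x = sphere_proj (Suc n) (G 1 x)" for x

  have "homotopic_with (\<lambda>_. True) (nsphere (Suc n)) (nsphere (Suc n))
      (\<lambda>x. sphere_proj (Suc n) (F 0 x)) (\<lambda>x. sphere_proj (Suc n) (F 1 x))"
  proof (rule homotopic_sphere_proj)
    show "continuous_map ?P euclideanreal (\<lambda>z. F (fst z) (snd z) i)" for i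
    proof (cases "i \<le> Suc n")
      case True
      then show ?thesis
        unfolding F_def by (simp, intro continuous_intros fst snd fc pc)
    qed (simp add: F_def)
    show "\<exists>i\<le>Suc n. F t x i \<noteq> 0" if t: "t \<in> {0..1}" and x: "x \<in> ?S" for t x
    proof -
      obtain i where i: "i \<le> Suc n" "1 / (real n + 2) \<le> \<bar>f x i\<bar>"
        using fbig[OF x] by blast
      have "\<bar>t * (f x i - p i x)\<bar> \<le> 1 * \<bar>f x i - p i x\<bar>"
        unfolding abs_mult using t by (intro mult_right_mono) auto
      then have "f x i \<noteq> t * (f x i - p i x)"
        using i(2) fp[OF i(1) x] less by auto
      then have "F t x i \<noteq> 0"
        using i by (simp add: F_def algebra_simps)
      with i show ?thesis by blast
    qed
  qed (simp add: F_def)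
  then have 1: "Brouwer_degree2 (Suc n) (\<lambda>x. sphere_proj (Suc n) (F 0 x))
              = Brouwer_degree2 (Suc n) (\<lambda>x. sphere_proj (Suc n) (F 1 x))"
    by (rule Brouwer_degree2_homotopic)
  have "sphere_proj (Suc n) (F 0 x) = f x" if "x \<in> ?S" for x
  proof -
    have "F 0 x = f x"
      using fS[OF that] by (auto simp: F_def topspace_nsphere fun_eq_iff)
    then show ?thesis using sphere_proj_nsphere[OF fS[OF that]] by simp
  qed
  then have 2: "Brouwer_degree2 (Suc n) (\<lambda>x. sphere_proj (Suc n) (F 0 x)) = Brouwer_degree2 (Suc n) f"
    by (rule Brouwer_degree2_eq)
  have 3: "F 1 x = G 0 x" for x
    by (auto simp: F_def G_def fun_eq_iff le_Suc_eq)
  have hom: "homotopic_with (\<lambda>_. True) (nsphere (Suc n)) (nsphere (Suc n))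
      (\<lambda>x. sphere_proj (Suc n) (G 0 x)) (\<lambda>x. sphere_proj (Suc n) (G 1 x))"
  proof (rule homotopic_sphere_proj)
    show "continuous_map ?P euclideanreal (\<lambda>z. G (fst z) (snd z) i)" for i
    proof -
      consider "i \<le> n" | "i = Suc n" | "i > Suc n" by linarith
      then show ?thesis
      proof cases
        case 1
        then show ?thesis
          unfolding G_def by (simp, intro continuous_intros fst snd pc) auto
      next
        case 2
        then show ?thesis
          unfolding G_def
          by (simp, intro continuous_intros fst snd pc continuous_map_nsphere_projection) auto
      qed (simp add: G_def)
    qed
    show "\<exists>i\<le>Suc n. G t x i \<noteq> 0" if t: "t \<in> {0..1}" and x: "x \<in> ?S" for t x
    proof (rule ccontr)
      assume neg: "\<not> (\<exists>i\<le>Suc n. G t x i \<noteq> 0)"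
      have A: "p i x = t * (c i * p (Suc n) x)" if "i \<le> n" for i
        using neg that by (auto simp: G_def dest: spec[of _ i])
      have B: "(1 - t * (1 - \<bar>x (Suc n)\<bar>)) * p (Suc n) x = 0"
        using neg by (auto simp: G_def dest: spec[of _ "Suc n"])
      \<comment> \<open>Unless the last component of \<open>p x\<close> is zero, this is only possible at time 1 on the equator,
        where the choice of \<open>c\<close> excludes it.\<close>
      show False
      proof (cases "p (Suc n) x = 0")
        case True
        then have "p i x = 0" if "i \<le> Suc n" for i
          using A that by (cases "i = Suc n") auto
        then show False using pbig[OF x] mu by auto
      next
        case False
        then have eq: "t * (1 - \<bar>x (Suc n)\<bar>) = 1" using B by simp
        have "t * (1 - \<bar>x (Suc n)\<bar>) \<le> t * 1"
          using t by (intro mult_left_mono) auto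
        with eq t have "t = 1" by auto
        with eq have "x (Suc n) = 0" by simp
        then have "x \<in> topspace (nsphere n)"
          using topspace_nsphere_minus1[OF x] by simp
        from c[OF this] A \<open>t = 1\<close> show False by auto
      qed
    qed
  qed (simp add: G_def)
  then have "Brouwer_degree2 (Suc n) (\<lambda>x. sphere_proj (Suc n) (G 0 x)) = Brouwer_degree2 (Suc n) q"
    unfolding q_def by (rule Brouwer_degree2_homotopic)
  with 1 2 3 have deg: "Brouwer_degree2 (Suc n) f = Brouwer_degree2 (Suc n) q" by simp
  have qc: "continuous_map (nsphere (Suc n)) (nsphere (Suc n)) q"
    using homotopic_with_imp_continuous_maps[OF hom] by (simp add: q_def[abs_def])
  have qodd: "q (\<lambda>i. - x i) = (\<lambda>i. - q x i)" for x
  proof -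
    have "G 1 (\<lambda>i. - x i) = (\<lambda>i. - G 1 x i)"
      by (auto simp: G_def podd fun_eq_iff)
    then show ?thesis by (simp add: q_def sphere_proj_uminus)
  qed
  have qeq: "q x \<in> topspace (nsphere n)" if "x \<in> topspace (nsphere n)" for x
  proof -
    have "q x \<in> ?S" using qc that sub by (auto simp: continuous_map_def)
    moreover have "q x (Suc n) = 0"
      using that by (simp add: q_def sphere_proj_def G_def topspace_nsphere)
    ultimately show ?thesis using topspace_nsphere_minus1[of "q x" "Suc n"] by simp
  qed
  have "even (Brouwer_degree2 (Suc n) q - Brouwer_degree2 (Suc n - Suc 0) q)"
    using qc qeq qodd by (intro Borsuk_odd_mapping_degree_step) auto
  moreover have "continuous_map (nsphere n) (nsphere n) q"
  proof -
    have "continuous_map (nsphere n) (nsphere (Suc n)) q"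
      using continuous_map_from_subtopology[OF qc] by (metis subtopology_nsphere_equator)
    moreover have "q \<in> topspace (nsphere n) \<rightarrow> {x. x (Suc n) = 0}"
      using qeq by (auto simp: topspace_nsphere)
    ultimately show ?thesis
      by (metis continuous_map_in_subtopology subtopology_nsphere_equator image_subset_iff_funcset)
  qed
  then have "odd (Brouwer_degree2 n q)"
    using qodd by (rule Suc.IH)
  ultimately show ?case by (simp add: deg)
qed

text \<open>
  For \<open>m \<le> n\<close> the map, normalised, would be an odd self-map of the \<open>n\<close>-sphere that misses the
  \<open>n\<close>-th unit vector, so that its degree would be both odd and zero.
\<close>

theorem Borsuk_Ulam_nsphere:
  assumes g: "continuous_map (nsphere n) (subtopology (Euclidean_space m) (- {\<lambda>i. 0})) g"
    and odd: "\<And>x. x \<in> topspace (nsphere n) \<Longrightarrow> g (\<lambda>i. - x i) = (\<lambda>i. - g x i)"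
  shows "n < m"
proof (rule ccontr)
  assume "\<not> n < m"
  then have mn: "m \<le> n" by simp
  let ?S = "topspace (nsphere n)"
  have g0: "g x i = 0" if "x \<in> ?S" "m \<le> i" for x i
    using g that by (auto simp: continuous_map_def topspace_Euclidean_space)
  have gnz: "g x \<noteq> (\<lambda>i. 0)" if "x \<in> ?S" for x
    using g that by (auto simp: continuous_map_def)
  have gc: "continuous_map (nsphere n) euclideanreal (\<lambda>x. g x i)" for i
    using g by (simp add: continuous_map_in_subtopology Euclidean_space_def continuous_map_componentwise_UNIV)
  define f where "f x = sphere_proj n (g x)" for x
  have fc: "continuous_map (nsphere n) (nsphere n) f"
    unfolding f_def
  proof (rule continuous_map_sphere_proj[OF gc])
    show "\<exists>i\<le>n. g x i \<noteq> 0" if "x \<in> ?S" for x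
      using gnz[OF that] g0[OF that] mn by (metis nle_le order_trans)
    show "g x i = 0" if "x \<in> ?S" "n < i" for x i
      using g0 that mn by simp
  qed
  have "odd (Brouwer_degree2 n f)"
    using fc by (rule odd_degree_of_odd_map) (simp add: f_def odd sphere_proj_uminus)
  moreover have "f ` ?S \<noteq> ?S"
  proof -
    let ?e = "\<lambda>i. if i = n then 1 else 0 :: real"
    have "?e \<in> ?S"
      by (simp add: topspace_nsphere if_distrib[where f = "\<lambda>x. x\<^sup>2"] cong: if_cong)
    moreover have "f x n = 0" if "x \<in> ?S" for x
      using g0[OF that mn] by (simp add: f_def sphere_proj_def)
    then have "?e \<notin> f ` ?S"
      by (metis (mono_tags, lifting) imageE one_neq_zero)
    ultimately show ?thesis by blast
  qed
  then have "Brouwer_degree2 n f = 0"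
    using fc by (intro Brouwer_degree2_nonsurjective)
  ultimately show False by simp
qed

section \<open>Normed spaces carried along an injection\<close>

text \<open>
  The injection \<open>r\<close> becomes a linear isometry onto the carrier \<open>range r\<close>. The inverse is written as
  \<open>inv_into UNIV\<close> because its usual notation denotes the group inverse here.
\<close>

definition nvs_of :: "('b::real_normed_vector \<Rightarrow> 'a) \<Rightarrow> 'a nvs" where
  "nvs_of r = \<lparr>vcarrier = range r, vadd = (\<lambda>x y. r (inv_into UNIV r x + inv_into UNIV r y)), vzero = r 0,
     vscale = (\<lambda>c x. r (c *\<^sub>R inv_into UNIV r x)), vnorm = (\<lambda>x. norm (inv_into UNIV r x))\<rparr>"

lemma vcarrier_nvs_of [simp]: "vcarrier (nvs_of r) = range r"
  and vzero_nvs_of [simp]: "vzero (nvs_of r) = r 0"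
  by (simp_all add: nvs_of_def)

locale embedding =
  fixes r :: "'b::real_normed_vector \<Rightarrow> 'a"
  assumes inj: "inj r"
begin

abbreviation "V \<equiv> nvs_of r"

lemma inv_r [simp]: "inv_into UNIV r (r x) = x"
  using inj by simp

lemma nvs_of_simps [simp]:
  "vadd V (r x) (r y) = r (x + y)" "vscale V c (r x) = r (c *\<^sub>R x)" "vnorm V (r x) = norm x"
  "vneg V (r x) = r (- x)" "vdist V (r x) (r y) = dist x y"
  by (simp_all add: nvs_of_def vneg_def vdist_def dist_norm)

lemma real_normed_space_nvs_of: "real_normed_space V"
  by unfold_locales
    (auto simp: algebra_simps inj_eq[OF inj] norm_triangle_ineq)

sublocale real_normed_space V
  by (rule real_normed_space_nvs_of)

sublocale M: Metric_space "range r" "vdist V"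
  using Metric_space_vdist by simp

lemma vtopology_nvs_of: "vtopology V = M.mtopology"
  by (simp add: vtopology_def)

lemma openin_vtopology: "openin (vtopology V) U \<longleftrightarrow> U \<subseteq> range r \<and> open (r -` U)"
proof -
  have ball: "M.mball (r x) e = r ` ball x e" for x e
    by (auto simp: M.mball_def)
  have "(\<forall>x. x \<in> U \<longrightarrow> (\<exists>e>0. M.mball x e \<subseteq> U)) \<longleftrightarrow> (\<forall>y\<in>r -` U. \<exists>e>0. ball y e \<subseteq> r -` U)"
    if "U \<subseteq> range r"
  proof -
    have "(\<forall>x. x \<in> U \<longrightarrow> Q x) \<longleftrightarrow> (\<forall>y\<in>r -` U. Q (r y))" for Q
      using that by blast
    then show ?thesis
      by (simp only: ball image_subset_iff_subset_vimage)
  qed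
  then show ?thesis
    unfolding vtopology_nvs_of M.openin_mtopology open_contains_ball by blast
qed

lemma topspace_vtopology [simp]: "topspace (vtopology V) = range r"
  by (simp add: vtopology_nvs_of)

lemma closedin_vtopology:
  assumes "closed A" shows "closedin (vtopology V) (r ` A)"
proof -
  have "r -` (range r - r ` A) = - A"
    by (auto simp: inj_eq[OF inj])
  then show ?thesis
    using assms by (auto simp: closedin_def openin_vtopology open_Compl)
qed

lemma continuous_map_vtopology:
  assumes "continuous_map X euclidean g" shows "continuous_map X (vtopology V) (\<lambda>x. r (g x))"
proof -
  have "openin X {x \<in> topspace X. r (g x) \<in> U}" if "openin (vtopology V) U" for U
    using openin_continuous_map_preimage[OF assms, of "r -` U"] that
    by (simp add: openin_vtopology)
  then show ?thesis by (simp add: continuous_map_def Pi_iff)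
qed

lemma limitin_vtopology:
  assumes "u \<longlonglongrightarrow> l" shows "limitin (vtopology V) (\<lambda>j. r (u j)) (r l) sequentially"
  unfolding vtopology_nvs_of M.limitin_metric
  using assms by (auto simp: tendsto_iff)

end

lemma real_banach_space_nvs_of:
  fixes r :: "'b::banach \<Rightarrow> 'a"
  assumes "inj r"
  shows "real_banach_space (nvs_of r)"
proof -
  interpret embedding r by unfold_locales (rule assms)
  show ?thesis
  proof
    show "Metric_space.mcomplete (vcarrier V) (vdist V)"
      unfolding vcarrier_nvs_of M.mcomplete_def
    proof (intro allI impI)
      fix \<sigma> assume \<sigma>: "M.MCauchy \<sigma>"
      define x where "x n = inv_into UNIV r (\<sigma> n)" for n
      have "\<sigma> n \<in> range r" for n
        using \<sigma> by (auto simp: M.MCauchy_def)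
      then have eq: "\<sigma> = (\<lambda>n. r (x n))"
        by (simp add: x_def f_inv_into_f fun_eq_iff)
      have "Cauchy x"
        using \<sigma> unfolding M.MCauchy_def eq Cauchy_def by simp
      then obtain l where "x \<longlonglongrightarrow> l"
        using Cauchy_convergent convergent_def by blast
      then show "\<exists>x. limitin M.mtopology \<sigma> x sequentially"
        using limitin_vtopology unfolding eq vtopology_nvs_of by blast
    qed
  qed
qed

locale inner_embedding = embedding r for r :: "'b::real_inner \<Rightarrow> 'a"
begin

text \<open>
  The supremum is attained at the normalised vector \<open>sgn g\<close>, also for \<open>g = 0\<close>.
\<close>

lemma dual_norm_inner:
  assumes "\<And>h. f (r h) = inner g h"
  shows "dual_norm V f = norm g"
proof -
  have "dual_norm V f = (SUP h\<in>{h. norm h \<le> 1}. \<bar>inner g h\<bar>)"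
  proof -
    have "{x \<in> vcarrier V. vnorm V x \<le> 1} = r ` {h. norm h \<le> 1}"
      by auto
    then show ?thesis
      by (simp add: dual_norm_def image_image assms)
  qed
  also have "\<dots> = norm g"
  proof (rule cSup_eq_maximum)
    have "norm (sgn g) \<le> 1" by (simp add: norm_sgn)
    moreover have "\<bar>inner g (sgn g)\<bar> = norm g"
      by (cases "g = 0") (simp_all add: sgn_div_norm power2_eq_square flip: power2_norm_eq_inner)
    ultimately show "norm g \<in> (\<lambda>h. \<bar>inner g h\<bar>) ` {h. norm h \<le> 1}"
      by (metis (mono_tags, lifting) imageI mem_Collect_eq)
    fix y assume "y \<in> (\<lambda>h. \<bar>inner g h\<bar>) ` {h. norm h \<le> 1}"
    then obtain h where h: "norm h \<le> 1" "y = \<bar>inner g h\<bar>" by auto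
    have "y \<le> norm g * norm h" unfolding h by (rule Cauchy_Schwarz_ineq2)
    also have "\<dots> \<le> norm g" using h by (simp add: mult_left_le)
    finally show "y \<le> norm g" .
  qed
  finally show ?thesis .
qed

lemma has_frechet_derivative_gradient:
  assumes D: "((\<lambda>x. I (r x)) has_derivative (\<lambda>h. inner g h)) (at u)"
  shows "has_frechet_derivative V I (restrict (\<lambda>x. inner g (inv_into UNIV r x)) (range r)) (r u)"
  unfolding has_frechet_derivative_def
proof
  have "\<bar>inner g h\<bar> \<le> norm g * norm h" for h
    by (rule Cauchy_Schwarz_ineq2)
  then show "restrict (\<lambda>x. inner g (inv_into UNIV r x)) (range r) \<in> vdual V"
    by (auto simp: vdual_def inner_add_right intro!: exI[of _ "norm g"])
  show "\<forall>\<epsilon>>0. \<exists>\<delta>>0. \<forall>h\<in>vcarrier V. vnorm V h < \<delta> \<longrightarrow>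
      \<bar>I (vadd V (r u) h) - I (r u) - restrict (\<lambda>x. inner g (inv_into UNIV r x)) (range r) h\<bar> \<le> \<epsilon> * vnorm V h"
  proof (intro allI impI)
    fix e :: real assume "e > 0"
    then obtain d where d: "d > 0" 
      "\<And>y. norm (y - u) < d \<Longrightarrow> norm (I (r y) - I (r u) - inner g (y - u)) \<le> e * norm (y - u)"
      using D unfolding has_derivative_at_alt by blast
    have "\<bar>I (r (u + h)) - I (r u) - inner g h\<bar> \<le> e * norm h" if "norm h < d" for h
      using d(2)[of "u + h"] that by simp
    with d(1) show "\<exists>\<delta>>0. \<forall>h\<in>vcarrier V. vnorm V h < \<delta> \<longrightarrow>
      \<bar>I (vadd V (r u) h) - I (r u) - restrict (\<lambda>x. inner g (inv_into UNIV r x)) (range r) h\<bar> \<le> e * vnorm V h"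
      by auto
  qed
qed

lemma frechet_gradient:
  assumes D: "((\<lambda>x. I (r x)) has_derivative (\<lambda>h. inner g h)) (at u)"
  shows "frechet V I (r u) (r h) = inner g h"
  by (simp add: frechet_eq[OF has_frechet_derivative_gradient[OF D]])

context
  fixes I :: "'a \<Rightarrow> real" and G :: "'b \<Rightarrow> 'b"
  assumes D: "\<And>u. ((\<lambda>x. I (r x)) has_derivative (\<lambda>h. inner (G u) h)) (at u)"
begin

lemma C1_functional_gradient:
  assumes "continuous_on UNIV G"
  shows "C1_functional V I"
  unfolding C1_functional_def
proof (intro conjI ballI allI impI)
  fix u assume "u \<in> vcarrier V"
  then obtain x where [simp]: "u = r x" by auto
  show "\<exists>f. has_frechet_derivative V I f u"
    using has_frechet_derivative_gradient[OF D] by auto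
  fix e :: real assume "e > 0"
  then obtain d where d: "d > 0" "\<And>y. dist y x < d \<Longrightarrow> dist (G y) (G x) < e"
    using assms by (meson UNIV_I continuous_on_iff)
  have "dual_norm V (\<lambda>h. frechet V I (r y) h - frechet V I (r x) h) = norm (G y - G x)" for y
    by (rule dual_norm_inner) (simp add: frechet_gradient[OF D] inner_diff_left)
  with d show "\<exists>\<delta>>0. \<forall>v\<in>vcarrier V. vdist V u v < \<delta> \<longrightarrow>
      dual_norm V (\<lambda>h. frechet V I v h - frechet V I u h) < e"
    by (intro exI[of _ d]) (auto simp: dist_commute simp flip: dist_norm)
qed

lemma critical_point_gradient: "critical_point V I (r u) \<longleftrightarrow> G u = 0"
  using inner_eq_zero_iff[of "G u"]
  by (auto simp: critical_point_def frechet_gradient[OF D])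

lemma palais_smale_gradient:
  assumes "\<And>u. (\<lambda>j. I (r (u j))) \<longlonglongrightarrow> c \<Longrightarrow> (\<lambda>j. G (u j)) \<longlonglongrightarrow> 0 \<Longrightarrow>
      \<exists>s l. strict_mono (s :: nat \<Rightarrow> nat) \<and> (u \<circ> s) \<longlonglongrightarrow> l"
  shows "palais_smale V I c"
  unfolding palais_smale_def
proof (intro allI impI)
  fix v :: "nat \<Rightarrow> 'a"
  assume v: "range v \<subseteq> vcarrier V" "(\<lambda>j. I (v j)) \<longlonglongrightarrow> c"
    "(\<lambda>j. dual_norm V (frechet V I (v j))) \<longlonglongrightarrow> 0"
  define u where "u j = inv_into UNIV r (v j)" for j
  have eq: "v = (\<lambda>j. r (u j))"
    using v(1) by (auto simp: u_def fun_eq_iff f_inv_into_f subset_iff)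
  have "dual_norm V (frechet V I (r (u j))) = norm (G (u j))" for j
    by (rule dual_norm_inner) (rule frechet_gradient[OF D])
  then have "(\<lambda>j. G (u j)) \<longlonglongrightarrow> 0"
    using v(3) by (simp add: eq tendsto_norm_zero_iff)
  with assms[of u] v(2) obtain s l where s: "strict_mono (s :: nat \<Rightarrow> nat)" "(u \<circ> s) \<longlonglongrightarrow> l"
    by (auto simp: eq)
  then have "limitin (vtopology V) (\<lambda>j. r ((u \<circ> s) j)) (r l) sequentially"
    by (intro limitin_vtopology)
  with s(1) show "\<exists>r l. strict_mono r \<and> limitin (vtopology V) (v \<circ> r) l sequentially"
    by (auto simp: eq o_def)
qed

end

end

section \<open>The Hilbert space of square-summable sequences\<close>

text \<open>
  A type with this carrier makes the type classes \<open>real_inner\<close> and \<open>banach\<close> available, and with them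
  the library's rules for derivatives and limits.
\<close>

typedef ell2 = "{x :: nat \<Rightarrow> real. summable (\<lambda>i. (x i)\<^sup>2)}"
  morphisms coord Abs_ell2
  by (rule exI[of _ "\<lambda>_. 0"]) simp

setup_lifting type_definition_ell2

lemma summable_coord_sq: "summable (\<lambda>i. (coord x i)\<^sup>2)"
  using coord by simp

lemma summable_mult_of_squares:
  fixes x y :: "nat \<Rightarrow> real"
  assumes "summable (\<lambda>i. (x i)\<^sup>2)" "summable (\<lambda>i. (y i)\<^sup>2)"
  shows "summable (\<lambda>i. x i * y i)"
proof (rule summable_comparison_test')
  show "summable (\<lambda>i. (x i)\<^sup>2 + (y i)\<^sup>2)"
    using assms by (rule summable_add)
  fix i
  have "2 * \<bar>x i * y i\<bar> \<le> (x i)\<^sup>2 + (y i)\<^sup>2"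
    using sum_squares_bound[of "\<bar>x i\<bar>" "\<bar>y i\<bar>"] by (simp add: abs_mult)
  then show "norm (x i * y i) \<le> (x i)\<^sup>2 + (y i)\<^sup>2"
    by simp
qed

lemma summable_add_sq:
  fixes x y :: "nat \<Rightarrow> real"
  assumes "summable (\<lambda>i. (x i)\<^sup>2)" "summable (\<lambda>i. (y i)\<^sup>2)"
  shows "summable (\<lambda>i. (x i + y i)\<^sup>2)"
  using summable_add[OF summable_add[OF assms] summable_mult[OF summable_mult_of_squares[OF assms], of 2]]
  by (simp add: power2_sum mult.assoc)

instantiation ell2 :: real_vector
begin

lift_definition zero_ell2 :: ell2 is "\<lambda>_. 0" by simp
lift_definition plus_ell2 :: "ell2 \<Rightarrow> ell2 \<Rightarrow> ell2" is "\<lambda>x y i. x i + y i"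
  by (rule summable_add_sq)
lift_definition uminus_ell2 :: "ell2 \<Rightarrow> ell2" is "\<lambda>x i. - x i" by simp
lift_definition minus_ell2 :: "ell2 \<Rightarrow> ell2 \<Rightarrow> ell2" is "\<lambda>x y i. x i - y i"
  using summable_add_sq[of _ "\<lambda>i. - y i" for y] by simp
lift_definition scaleR_ell2 :: "real \<Rightarrow> ell2 \<Rightarrow> ell2" is "\<lambda>c x i. c * x i"
  by (simp add: power_mult_distrib summable_mult)

instance
  by standard (transfer; simp add: algebra_simps)+

end

lemma coord_simps [simp]:
  "coord 0 i = 0" "coord (x + y) i = coord x i + coord y i" "coord (- x) i = - coord x i"
  "coord (x - y) i = coord x i - coord y i" "coord (c *\<^sub>R x) i = c * coord x i"
  by (simp_all add: zero_ell2.rep_eq plus_ell2.rep_eq uminus_ell2.rep_eq minus_ell2.rep_eq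
      scaleR_ell2.rep_eq)

lemma ell2_eqI: "(\<And>i. coord x i = coord y i) \<Longrightarrow> x = y"
  by (simp add: coord_inject[symmetric] fun_eq_iff)

instantiation ell2 :: real_inner
begin

definition inner_ell2 :: "ell2 \<Rightarrow> ell2 \<Rightarrow> real" where
  "inner_ell2 x y = suminf (\<lambda>i. coord x i * coord y i)"
definition norm_ell2 :: "ell2 \<Rightarrow> real" where "norm_ell2 x = sqrt (inner x x)"
definition dist_ell2 :: "ell2 \<Rightarrow> ell2 \<Rightarrow> real" where "dist_ell2 x y = norm (x - y)"
definition sgn_ell2 :: "ell2 \<Rightarrow> ell2" where "sgn_ell2 x = x /\<^sub>R norm x"
definition uniformity_ell2 :: "(ell2 \<times> ell2) filter" where
  "uniformity_ell2 = (INF e\<in>{0<..}. principal {(x, y). dist x y < e})"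
definition open_ell2 :: "ell2 set \<Rightarrow> bool" where
  "open_ell2 U \<longleftrightarrow> (\<forall>x\<in>U. \<forall>\<^sub>F (x', y) in uniformity. x' = x \<longrightarrow> y \<in> U)"

instance
proof
  fix x y z :: ell2 and r :: real
  have s: "summable (\<lambda>i. coord x i * coord y i)" for x y
    by (intro summable_mult_of_squares summable_coord_sq)
  show "inner x y = inner y x"
    by (simp add: inner_ell2_def mult.commute)
  show "inner (x + y) z = inner x z + inner y z"
    by (simp add: inner_ell2_def distrib_right suminf_add s)
  show "inner (r *\<^sub>R x) y = r * inner x y"
    by (simp add: inner_ell2_def mult.assoc suminf_mult s)
  show "0 \<le> inner x x"
    by (simp add: inner_ell2_def suminf_nonneg s)
  show "inner x x = 0 \<longleftrightarrow> x = 0"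
    unfolding inner_ell2_def
    by (subst suminf_eq_zero_iff[OF s]) (auto intro!: ell2_eqI)
qed (simp_all add: norm_ell2_def dist_ell2_def sgn_ell2_def uniformity_ell2_def open_ell2_def)

end

lemma summable_coord_mult: "summable (\<lambda>i. coord x i * coord y i)"
  by (intro summable_mult_of_squares summable_coord_sq)

lemma norm_ell2_sq: "(norm x)\<^sup>2 = suminf (\<lambda>i. (coord x i)\<^sup>2)"
  by (simp only: power2_norm_eq_inner inner_ell2_def) (simp add: power2_eq_square)

text \<open>
  All operators below are diagonal, so their norm estimates are made coordinate by coordinate.
\<close>

lemma norm_ell2_mono:
  assumes "\<And>i. \<bar>coord x i\<bar> \<le> \<bar>coord y i\<bar>"
  shows "norm x \<le> norm y"
proof -
  have "(norm x)\<^sup>2 \<le> (norm y)\<^sup>2"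
    unfolding norm_ell2_sq 
    by (intro suminf_le summable_coord_sq) (use assms in \<open>simp add: abs_le_square_iff\<close>)
  then show ?thesis by (simp add: power_mono_iff)
qed

lemma sum_coord_sq_le: "finite F \<Longrightarrow> (\<Sum>i\<in>F. (coord x i)\<^sup>2) \<le> (norm x)\<^sup>2"
  unfolding norm_ell2_sq by (intro sum_le_suminf summable_coord_sq) auto

lemma coord_le_norm: "\<bar>coord x i\<bar> \<le> norm x"
  using sum_coord_sq_le[of "{i}" x] abs_le_square_iff[of "coord x i" "norm x"] by simp

lemma bounded_linear_coord: "bounded_linear (\<lambda>x. coord x i)"
  by (rule bounded_linear_intro[where K = 1]) (simp_all add: coord_le_norm)

instance ell2 :: banach
proof
  fix X :: "nat \<Rightarrow> ell2" assume X: "Cauchy X"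
  have "Cauchy (\<lambda>n. coord (X n) i)" for i
    by (rule bounded_linear.Cauchy[OF bounded_linear_coord X])
  then have "\<exists>l. (\<lambda>n. coord (X n) i) \<longlonglongrightarrow> l" for i
    using Cauchy_convergent convergent_def by blast
  then obtain y where y: "\<And>i. (\<lambda>n. coord (X n) i) \<longlonglongrightarrow> y i" by metis
  \<comment> \<open>Bounds on partial sums of squares survive the coordinatewise limit.\<close>
  have tail: "\<exists>M. \<forall>m\<ge>M. \<forall>N. (\<Sum>i<N. (coord (X m) i - y i)\<^sup>2) \<le> e\<^sup>2" if e: "e > 0" for e
  proof -
    obtain M where M: "\<And>m n. m \<ge> M \<Longrightarrow> n \<ge> M \<Longrightarrow> norm (X m - X n) < e"
      using CauchyD[OF X e] by blast
    have "(\<Sum>i<N. (coord (X m) i - y i)\<^sup>2) \<le> e\<^sup>2" if m: "m \<ge> M" for m N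
    proof (rule LIMSEQ_le_const2)
      show "(\<lambda>n. \<Sum>i<N. (coord (X m) i - coord (X n) i)\<^sup>2) \<longlonglongrightarrow> (\<Sum>i<N. (coord (X m) i - y i)\<^sup>2)"
        by (intro tendsto_intros y)
      have "(\<Sum>i<N. (coord (X m) i - coord (X n) i)\<^sup>2) \<le> e\<^sup>2" if "n \<ge> M" for n
      proof -
        have "(\<Sum>i<N. (coord (X m - X n) i)\<^sup>2) \<le> (norm (X m - X n))\<^sup>2"
          by (intro sum_coord_sq_le) auto
        also have "\<dots> \<le> e\<^sup>2"
          using M[OF m that] by (intro power_mono) auto
        finally show ?thesis by simp
      qed
      then show "\<exists>n0. \<forall>n\<ge>n0. (\<Sum>i<N. (coord (X m) i - coord (X n) i)\<^sup>2) \<le> e\<^sup>2"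
        by blast
    qed
    then show ?thesis by blast
  qed
  have sq: "summable (\<lambda>i. (coord (X m) i - y i)\<^sup>2) \<and> suminf (\<lambda>i. (coord (X m) i - y i)\<^sup>2) \<le> e\<^sup>2"
    if "\<forall>N. (\<Sum>i<N. (coord (X m) i - y i)\<^sup>2) \<le> e\<^sup>2" for m e
    using that by (auto intro!: summableI_nonneg_bounded suminf_le_const)
  obtain m0 where "summable (\<lambda>i. (coord (X m0) i - y i)\<^sup>2)"
    using tail[of 1] sq by (metis order_refl zero_less_one)
  then have "summable (\<lambda>i. (coord (X m0) i + - (coord (X m0) i - y i))\<^sup>2)"
    by (intro summable_add_sq summable_coord_sq) (simp add: power2_commute)
  then have ys: "summable (\<lambda>i. (y i)\<^sup>2)" by simp
  have cy: "coord (Abs_ell2 y) = y" using ys by (simp add: Abs_ell2_inverse)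
  have "X \<longlonglongrightarrow> Abs_ell2 y"
  proof (rule LIMSEQ_I)
    fix e :: real assume e: "e > 0"
    obtain M where M: "\<forall>m\<ge>M. \<forall>N. (\<Sum>i<N. (coord (X m) i - y i)\<^sup>2) \<le> (e / 2)\<^sup>2"
      using tail[of "e / 2"] e by auto
    have "norm (X m - Abs_ell2 y) < e" if "m \<ge> M" for m
    proof -
      have "(norm (X m - Abs_ell2 y))\<^sup>2 \<le> (e / 2)\<^sup>2"
        using sq M that by (simp add: norm_ell2_sq cy)
      then have "norm (X m - Abs_ell2 y) \<le> e / 2"
        using e by (simp add: power2_le_iff_abs_le)
      with e show ?thesis by simp
    qed
    then show "\<exists>M. \<forall>m\<ge>M. norm (X m - Abs_ell2 y) < e" by blast
  qed
  then show "convergent X" by (auto simp: convergent_def)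
qed

section \<open>The energy functional\<close>

lift_definition ell2_unit :: "nat \<Rightarrow> ell2" is "\<lambda>i j. if j = i then 1 else 0"
  by (rule summable_finite[of "{i}" for i]) auto

lift_definition weigh :: "ell2 \<Rightarrow> ell2" is "\<lambda>x i. x i / (real i + 1)"
proof (rule summable_comparison_test')
  fix x :: "nat \<Rightarrow> real" and i
  assume "summable (\<lambda>i. (x i)\<^sup>2)"
  then show "summable (\<lambda>i. (x i)\<^sup>2)" .
  have "(x i)\<^sup>2 / (real i + 1)\<^sup>2 \<le> (x i)\<^sup>2 / 1"
    by (intro divide_left_mono) auto
  then show "norm ((x i / (real i + 1))\<^sup>2) \<le> (x i)\<^sup>2"
    by (simp add: power_divide)
qed

lemma coord_weigh [simp]: "coord (weigh x) i = coord x i / (real i + 1)"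
  by (simp add: weigh.rep_eq)

lemma coord_ell2_unit [simp]: "coord (ell2_unit i) j = (if j = i then 1 else 0)"
  by (simp add: ell2_unit.rep_eq)

lemma bounded_linear_weigh: "bounded_linear weigh"
proof (rule bounded_linear_intro[where K = 1])
  show "norm (weigh x) \<le> norm x * 1" for x
  proof -
    have "\<bar>coord x i\<bar> / (real i + 1) \<le> \<bar>coord x i\<bar> / 1" for i
      by (intro divide_left_mono) auto
    then show ?thesis by (simp add: norm_ell2_mono)
  qed
qed (auto intro!: ell2_eqI simp: add_divide_distrib)

lemma inner_weigh_commute: "inner (weigh x) y = inner x (weigh y)"
  by (simp add: inner_ell2_def)

lemma inner_weigh_eq: "inner (weigh x) x = suminf (\<lambda>i. (coord x i)\<^sup>2 / (real i + 1))"
  by (simp add: inner_ell2_def power2_eq_square)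

lemma summable_inner_weigh: "summable (\<lambda>i. (coord x i)\<^sup>2 / (real i + 1))"
  using summable_coord_mult[of "weigh x" x] by (simp add: power2_eq_square)

lemma inner_weigh_nonneg: "0 \<le> inner (weigh x) x"
  unfolding inner_weigh_eq by (intro suminf_nonneg summable_inner_weigh) auto

lemma inner_weigh_eq_0_iff: "inner (weigh x) x = 0 \<longleftrightarrow> x = 0"
  unfolding inner_weigh_eq
  by (subst suminf_eq_zero_iff[OF summable_inner_weigh]) (auto intro!: ell2_eqI)

lemma inner_weigh_le: "inner (weigh x) x \<le> inner x x"
proof -
  have "(coord x i)\<^sup>2 / (real i + 1) \<le> (coord x i)\<^sup>2 / 1" for i
    by (intro divide_left_mono) auto
  then have "inner (weigh x) x \<le> suminf (\<lambda>i. (coord x i)\<^sup>2)"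
    unfolding inner_weigh_eq by (intro suminf_le summable_inner_weigh summable_coord_sq) auto
  then show ?thesis by (simp add: norm_ell2_sq flip: power2_norm_eq_inner)
qed

definition energy :: "ell2 \<Rightarrow> real" where
  "energy u = - inner (weigh u) u / (1 + (inner u u)\<^sup>2)"

definition gradient :: "ell2 \<Rightarrow> ell2" where
  "gradient u = (- 2 / (1 + (inner u u)\<^sup>2)) *\<^sub>R (weigh u + (2 * inner u u * energy u) *\<^sub>R u)"

lemma one_plus_square_pos: "0 < 1 + (x::real)\<^sup>2"
  by (simp add: add_pos_nonneg)

lemma one_plus_square_nz: "1 + (x::real)\<^sup>2 \<noteq> 0"
  using one_plus_square_pos[of x] by linarith

lemma has_derivative_energy: "(energy has_derivative (\<lambda>h. inner (gradient u) h)) (at u)"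
proof -
  note [derivative_intros] = bounded_linear.has_derivative[OF bounded_linear_weigh]
  let ?D = "1 + (inner u u)\<^sup>2"
  have "(energy has_derivative (\<lambda>h. (- (inner (weigh u) h + inner (weigh h) u) * ?D
      - - inner (weigh u) u * (2 * inner u u * (inner u h + inner h u))) / (?D * ?D))) (at u)"
    unfolding energy_def[abs_def]
    by (rule has_derivative_divide' has_derivative_eq_rhs)
       (auto intro!: derivative_eq_intros simp: one_plus_square_nz algebra_simps)
  moreover have "(- (inner (weigh u) h + inner (weigh h) u) * ?D
      - - inner (weigh u) u * (2 * inner u u * (inner u h + inner h u))) / (?D * ?D)
      = inner (gradient u) h" for h
  proof -
    have 1: "inner (weigh h) u = inner (weigh u) h"
      by (metis inner_weigh_commute inner_commute)
    have 2: "energy u * ?D = - inner (weigh u) u"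
      by (simp add: energy_def one_plus_square_nz)
    have cancel: "(- 2 / D * X) * (D * D) = - 2 * X * D" if "D \<noteq> 0" for D X :: real
      using that by simp
    have "inner (gradient u) h * (?D * ?D)
        = - 2 * (inner (weigh u) h + 2 * inner u u * energy u * inner u h) * ?D"
      unfolding gradient_def inner_scaleR_left inner_add_left
      by (rule cancel[OF one_plus_square_nz])
    also have "\<dots> = - 2 * (inner (weigh u) h * ?D + 2 * inner u u * (energy u * ?D) * inner u h)"
      by (simp add: algebra_simps)
    also have "\<dots> = - (inner (weigh u) h + inner (weigh h) u) * ?D
      - - inner (weigh u) u * (2 * inner u u * (inner u h + inner h u))"
      unfolding 1 2 by (simp add: inner_commute algebra_simps)
    finally have eq: "inner (gradient u) h * (?D * ?D) = \<dots>" .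
    show ?thesis
      unfolding eq[symmetric] using one_plus_square_nz[of "inner u u"] by simp
  qed
  ultimately show ?thesis by simp
qed

lemma continuous_on_gradient: "continuous_on UNIV gradient"
  unfolding gradient_def[abs_def] energy_def
  by (intro continuous_intros bounded_linear.continuous_on[OF bounded_linear_weigh])
     (simp_all add: one_plus_square_nz)

lemma energy_times: "energy u * (1 + (inner u u)\<^sup>2) = - inner (weigh u) u"
  by (simp add: energy_def one_plus_square_nz)

lemma energy_nonpos: "energy u \<le> 0"
  using inner_weigh_nonneg[of u] one_plus_square_pos[of "inner u u"]
  by (simp add: energy_def)

lemma energy_eq_0_iff: "energy u = 0 \<longleftrightarrow> u = 0"
  by (simp add: energy_def one_plus_square_nz inner_weigh_eq_0_iff)

text \<open>
  With \<open>\<rho> = \<parallel>u\<parallel>\<^sup>2\<close>, both estimates follow from \<open>\<bar>I(u)\<bar> (1 + \<rho>\<^sup>2) = \<langle>Au, u\<rangle> \<le> \<rho>\<close>. They keep \<open>\<rho>\<close>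
  away from \<open>0\<close> and from \<open>\<infinity>\<close> as long as \<open>I(u)\<close> stays away from \<open>0\<close>.
\<close>

lemma energy_le_inner: "\<bar>energy u\<bar> \<le> inner u u"
  and inner_mult_energy_le: "inner u u * \<bar>energy u\<bar> \<le> 1"
proof -
  define \<rho> where "\<rho> = inner u u"
  have \<rho>: "\<rho> \<ge> 0" by (simp add: \<rho>_def)
  have le: "\<bar>energy u\<bar> * (1 + \<rho>\<^sup>2) \<le> \<rho>"
    using energy_times[of u] inner_weigh_le[of u] energy_nonpos[of u] by (simp add: \<rho>_def)
  have "\<bar>energy u\<bar> * 1 \<le> \<bar>energy u\<bar> * (1 + \<rho>\<^sup>2)"
    by (intro mult_left_mono) auto
  with le show "\<bar>energy u\<bar> \<le> inner u u" by (simp add: \<rho>_def)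
  have "(\<rho> * \<bar>energy u\<bar>) * (1 + \<rho>\<^sup>2) \<le> \<rho> * \<rho>"
    using mult_left_mono[OF le \<rho>] by (simp add: mult_ac)
  also have "\<dots> \<le> 1 * (1 + \<rho>\<^sup>2)" by (simp add: power2_eq_square)
  finally show "inner u u * \<bar>energy u\<bar> \<le> 1"
    using one_plus_square_pos[of \<rho>] by (simp add: \<rho>_def)
qed

lemma gradient_0: "gradient 0 = 0"
proof -
  have "weigh 0 = 0" by (intro ell2_eqI) simp
  then show ?thesis by (simp add: gradient_def)
qed

text \<open>
  The radial component of the gradient decides: the inner product of \<open>Au + 2\<rho> I(u) u = 0\<close>
  with \<open>u\<close>, combined with \<open>I(u) (1 + \<rho>\<^sup>2) = - \<langle>Au, u\<rangle>\<close>, gives \<open>I(u) (\<rho>\<^sup>2 - 1) = 0\<close>.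
\<close>

lemma norm_critical_point:
  assumes "gradient u = 0" "energy u < 0"
  shows "norm u = 1"
proof -
  define \<rho> where "\<rho> = inner u u"
  have "weigh u + (2 * \<rho> * energy u) *\<^sub>R u = 0"
    using assms(1) by (simp add: gradient_def \<rho>_def one_plus_square_nz)
  then have "inner (weigh u + (2 * \<rho> * energy u) *\<^sub>R u) u = 0" by simp
  then have "inner (weigh u) u + 2 * (energy u * \<rho>\<^sup>2) = 0"
    by (simp add: inner_add_left \<rho>_def power2_eq_square mult_ac)
  moreover have "energy u + energy u * \<rho>\<^sup>2 = - inner (weigh u) u"
    using energy_times[of u] by (simp add: \<rho>_def distrib_left)
  ultimately have "energy u * \<rho>\<^sup>2 = energy u" by linarith
  then have "\<rho>\<^sup>2 = 1" using assms(2) by simp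
  then have "\<rho> = 1" by (simp add: power2_eq_1_iff \<rho>_def) (metis inner_ge_zero not_one_le_zero neg_0_le_iff_le)
  then show ?thesis by (simp add: norm_eq_1 \<rho>_def)
qed

text \<open>
  Here the eigenvalues must be distinct and tend to \<open>0\<close>; the exceptional index \<open>i\<close> is the one
  with \<open>1/(i + 1) = \<kappa>\<close>, if there is one.
\<close>

lemma weights_avoid:
  fixes \<kappa> :: real
  assumes "\<kappa> > 0"
  obtains i d where "d > 0" "\<And>j. j \<noteq> i \<Longrightarrow> d \<le> \<bar>1 / (real j + 1) - \<kappa>\<bar>"
proof -
  define w where "w j = 1 / (real j + 1)" for j :: nat
  obtain N :: nat where N: "real N > 2 / \<kappa>" using reals_Archimedean2 by blast
  have tail: "w j \<le> \<kappa> / 2" if "j \<ge> N" for j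
  proof -
    have "2 / \<kappa> \<le> real j + 1" using N that by linarith
    then show ?thesis using assms by (simp add: w_def field_simps)
  qed
  obtain d where d: "d > 0" "\<And>x. x \<in> w ` {..<N} \<Longrightarrow> x \<noteq> \<kappa> \<Longrightarrow> d \<le> dist \<kappa> x"
    using finite_set_avoid[of "w ` {..<N}" \<kappa>] by blast
  obtain i where i: "\<And>j. j \<noteq> i \<Longrightarrow> w j \<noteq> \<kappa>"
  proof (cases "\<exists>i. w i = \<kappa>")
    case True
    then obtain i where "w i = \<kappa>" by blast
    then have "w j \<noteq> \<kappa>" if "j \<noteq> i" for j using that by (auto simp: w_def)
    then show thesis by (rule that)
  qed (use that in blast)
  have "min d (\<kappa> / 2) \<le> \<bar>w j - \<kappa>\<bar>" if "j \<noteq> i" for j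
  proof (cases "j < N")
    case True
    then have "d \<le> dist \<kappa> (w j)" using d i that by blast
    then show ?thesis by (simp add: dist_real_def)
  next
    case False
    then have "w j \<le> \<kappa> / 2" using tail by simp
    then show ?thesis by linarith
  qed
  with d assms show thesis by (intro that[of "min d (\<kappa> / 2)" i]) (auto simp: w_def)
qed

lemma norm_remove_coord_le:
  assumes d: "d > 0" "\<And>j. j \<noteq> i \<Longrightarrow> d \<le> \<bar>1 / (real j + 1) - \<kappa>\<bar>"
  shows "norm (u - coord u i *\<^sub>R ell2_unit i) \<le> norm (weigh u - \<kappa> *\<^sub>R u) / d"
proof -
  have "norm (u - coord u i *\<^sub>R ell2_unit i) \<le> norm ((1 / d) *\<^sub>R (weigh u - \<kappa> *\<^sub>R u))"
  proof (rule norm_ell2_mono)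
    fix j
    show "\<bar>coord (u - coord u i *\<^sub>R ell2_unit i) j\<bar> \<le> \<bar>coord ((1 / d) *\<^sub>R (weigh u - \<kappa> *\<^sub>R u)) j\<bar>"
    proof (cases "j = i")
      case False
      have "d * \<bar>coord u j\<bar> \<le> \<bar>1 / (real j + 1) - \<kappa>\<bar> * \<bar>coord u j\<bar>"
        using d(2)[OF False] by (intro mult_right_mono) auto
      also have "\<dots> = \<bar>coord (weigh u - \<kappa> *\<^sub>R u) j\<bar>"
        by (simp add: left_diff_distrib flip: abs_mult)
      finally have "\<bar>coord u j\<bar> \<le> \<bar>coord (weigh u - \<kappa> *\<^sub>R u) j\<bar> / d"
        using d(1) by (subst pos_le_divide_eq) (simp_all add: mult.commute)
      also have "\<dots> = \<bar>coord ((1 / d) *\<^sub>R (weigh u - \<kappa> *\<^sub>R u)) j\<bar>"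
        using d(1) by (simp add: abs_mult del: coord_weigh coord_simps(4))
      finally show ?thesis
        using False by simp
    qed simp
  qed
  also have "\<dots> = norm (weigh u - \<kappa> *\<^sub>R u) / d" using d(1) by simp
  finally show ?thesis .
qed

text \<open>
  Since \<open>\<kappa> = - 2\<rho> I(u)\<close> lies between \<open>2 I(u)\<^sup>2\<close> and \<open>2\<close>, it has a positive accumulation point \<open>\<kappa>\<^sub>0\<close>, and
  boundedness of \<open>u\<close> gives \<open>Au - \<kappa>\<^sub>0 u \<rightarrow> 0\<close> along a subsequence. Hence all of \<open>u\<close> but one
  coordinate tends to \<open>0\<close>, and that coordinate is a bounded real sequence.
\<close>

lemma palais_smale_energy:
  assumes c: "c < 0" and I: "(\<lambda>j. energy (u j)) \<longlonglongrightarrow> c" and G: "(\<lambda>j. gradient (u j)) \<longlonglongrightarrow> 0"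
  shows "\<exists>s l. strict_mono (s :: nat \<Rightarrow> nat) \<and> (u \<circ> s) \<longlonglongrightarrow> l"
proof -
  define \<rho> where "\<rho> j = inner (u j) (u j)" for j
  define \<kappa> where "\<kappa> j = - 2 * \<rho> j * energy (u j)" for j
  have \<rho>0: "0 \<le> \<rho> j" for j by (simp add: \<rho>_def)
  have "\<kappa> j = 2 * (\<rho> j * \<bar>energy (u j)\<bar>)" for j
    using energy_nonpos[of "u j"] by (simp add: \<kappa>_def)
  then have \<kappa>2: "\<bar>\<kappa> j\<bar> \<le> 2" and \<kappa>ge: "2 * (energy (u j))\<^sup>2 \<le> \<kappa> j" for j
    using inner_mult_energy_le[of "u j"] \<rho>0[of j]
      mult_right_mono[OF energy_le_inner[of "u j"], of "\<bar>energy (u j)\<bar>"]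
    by (simp_all add: \<rho>_def power2_eq_square)
  have "(\<lambda>j. inverse (energy (u j))) \<longlonglongrightarrow> inverse c"
    using c by (intro tendsto_inverse I) auto
  then have "Bseq (\<lambda>j. inverse (energy (u j)))"
    by (intro convergent_imp_Bseq convergentI)
  then obtain K where K: "K > 0" "\<And>j. \<bar>inverse (energy (u j))\<bar> \<le> K"
    by (auto elim: BseqE)
  \<comment> \<open>The bound also holds when the energy vanishes, since then \<open>u j = 0\<close> and \<open>inverse 0 = 0\<close>.\<close>
  have \<rho>K: "\<rho> j \<le> K" for j
  proof (cases "u j = 0")
    case False
    then have "\<bar>energy (u j)\<bar> > 0" by (simp add: energy_eq_0_iff)
    then have "\<rho> j \<le> \<bar>inverse (energy (u j))\<bar>"
      using inner_mult_energy_le[of "u j"] by (simp add: \<rho>_def field_simps)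
    also have "\<dots> \<le> K" by (rule K)
    finally show ?thesis .
  qed (use K in \<open>simp add: \<rho>_def\<close>)
  have uK: "norm (u j) \<le> 1 + K" for j
  proof -
    have "2 * norm (u j) \<le> 1 + (norm (u j))\<^sup>2"
      using sum_squares_bound[of "norm (u j)" 1] by simp
    then have "norm (u j) \<le> 1 + (norm (u j))\<^sup>2"
      using norm_ge_zero[of "u j"] by linarith
    also have "\<dots> \<le> 1 + K" using \<rho>K[of j] by (simp add: \<rho>_def power2_norm_eq_inner)
    finally show ?thesis .
  qed
  obtain \<kappa>0 s where s: "strict_mono s" and lim: "(\<kappa> \<circ> s) \<longlonglongrightarrow> \<kappa>0"
    using bounded_imp_convergent_subsequence[OF boundedI[of "range \<kappa>" 2]] \<kappa>2 by auto
  have "(\<lambda>j. 2 * (energy (u (s j)))\<^sup>2) \<longlonglongrightarrow> 2 * c\<^sup>2"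
    using LIMSEQ_subseq_LIMSEQ[OF I s] by (intro tendsto_intros) (simp add: o_def)
  then have "2 * c\<^sup>2 \<le> \<kappa>0"
    using lim by (rule LIMSEQ_le) (auto simp: \<kappa>ge)
  moreover have "0 < c\<^sup>2" using c by simp
  ultimately have \<kappa>0: "\<kappa>0 > 0" by linarith

  define v where "v j = weigh (u (s j)) - \<kappa>0 *\<^sub>R u (s j)" for j
  have "v \<longlonglongrightarrow> 0"
  proof (rule Lim_null_comparison)
    have cancel: "(- D / 2) *\<^sub>R ((- 2 / D) *\<^sub>R x) = x" if "D \<noteq> 0" for D :: real and x :: ell2
      using that by simp
    have eq: "v j = (- (1 + (\<rho> (s j))\<^sup>2) / 2) *\<^sub>R gradient (u (s j)) + (\<kappa> (s j) - \<kappa>0) *\<^sub>R u (s j)" for j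
      unfolding gradient_def \<rho>_def cancel[OF one_plus_square_nz]
      by (simp add: v_def \<kappa>_def \<rho>_def algebra_simps)
    show "\<forall>\<^sub>F j in sequentially. norm (v j) \<le>
        (1 + K\<^sup>2) * norm (gradient (u (s j))) + \<bar>\<kappa> (s j) - \<kappa>0\<bar> * (1 + K)"
    proof (rule always_eventually, rule allI)
      fix j
      have "norm (v j) \<le> \<bar>- (1 + (\<rho> (s j))\<^sup>2) / 2\<bar> * norm (gradient (u (s j))) + \<bar>\<kappa> (s j) - \<kappa>0\<bar> * norm (u (s j))"
        unfolding eq by (metis norm_scaleR norm_triangle_ineq)
      also have "\<dots> \<le> (1 + K\<^sup>2) * norm (gradient (u (s j))) + \<bar>\<kappa> (s j) - \<kappa>0\<bar> * (1 + K)"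
      proof (intro add_mono mult_mono)
        have "(\<rho> (s j))\<^sup>2 \<le> K\<^sup>2" by (intro power_mono \<rho>K \<rho>0)
        then show "\<bar>- (1 + (\<rho> (s j))\<^sup>2) / 2\<bar> \<le> 1 + K\<^sup>2"
          using zero_le_power2[of "\<rho> (s j)"] zero_le_power2[of K]
          by (simp add: abs_if field_simps)
      qed (auto simp: uK)
      finally show "norm (v j) \<le> (1 + K\<^sup>2) * norm (gradient (u (s j))) + \<bar>\<kappa> (s j) - \<kappa>0\<bar> * (1 + K)" .
    qed
    have "(\<lambda>j. gradient (u (s j))) \<longlonglongrightarrow> 0"
      using LIMSEQ_subseq_LIMSEQ[OF G s] by (simp add: o_def)
    moreover have "(\<lambda>j. \<kappa> (s j)) \<longlonglongrightarrow> \<kappa>0"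
      using lim by (simp add: o_def)
    ultimately have "(\<lambda>j. (1 + K\<^sup>2) * norm (gradient (u (s j))) + \<bar>\<kappa> (s j) - \<kappa>0\<bar> * (1 + K))
        \<longlonglongrightarrow> (1 + K\<^sup>2) * norm (0 :: ell2) + \<bar>\<kappa>0 - \<kappa>0\<bar> * (1 + K)"
      by (intro tendsto_intros)
    then show "(\<lambda>j. (1 + K\<^sup>2) * norm (gradient (u (s j))) + \<bar>\<kappa> (s j) - \<kappa>0\<bar> * (1 + K)) \<longlonglongrightarrow> 0"
      by simp
  qed

  obtain i d where d: "d > 0" "\<And>j. j \<noteq> i \<Longrightarrow> d \<le> \<bar>1 / (real j + 1) - \<kappa>0\<bar>"
    using weights_avoid[OF \<kappa>0] by blast
  define a where "a j = coord (u (s j)) i" for j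
  have "\<bar>a j\<bar> \<le> 1 + K" for j
    using coord_le_norm uK unfolding a_def by (rule order_trans)
  then obtain \<xi> t where t: "strict_mono t" and \<xi>: "(a \<circ> t) \<longlonglongrightarrow> \<xi>"
    using bounded_imp_convergent_subsequence[OF boundedI[of "range a" "1 + K"]] by auto
  have "(\<lambda>j. u (s j) - a j *\<^sub>R ell2_unit i) \<longlonglongrightarrow> 0"
  proof (rule Lim_null_comparison)
    show "\<forall>\<^sub>F j in sequentially. norm (u (s j) - a j *\<^sub>R ell2_unit i) \<le> norm (v j) / d"
      unfolding a_def v_def by (intro always_eventually allI norm_remove_coord_le d)
    have "(\<lambda>j. norm (v j) / d) \<longlonglongrightarrow> norm (0 :: ell2) / d"
      using d(1) by (intro tendsto_intros \<open>v \<longlonglongrightarrow> 0\<close>) auto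
    then show "(\<lambda>j. norm (v j) / d) \<longlonglongrightarrow> 0" by simp
  qed
  from LIMSEQ_subseq_LIMSEQ[OF this t]
  have "(\<lambda>j. (u (s (t j)) - a (t j) *\<^sub>R ell2_unit i) + a (t j) *\<^sub>R ell2_unit i) \<longlonglongrightarrow> 0 + \<xi> *\<^sub>R ell2_unit i"
    using \<xi> by (intro tendsto_intros) (auto simp: o_def)
  then have "(u \<circ> (s \<circ> t)) \<longlonglongrightarrow> \<xi> *\<^sub>R ell2_unit i"
    by (simp add: o_def)
  moreover have "strict_mono (s \<circ> t)" using s t by (rule strict_mono_o)
  ultimately show ?thesis by blast
qed

section \<open>Finite-dimensional spheres and the counterexample\<close>

global_interpretation ell2: inner_embedding coord
  by unfold_locales (simp add: inj_def coord_inject)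

abbreviation "ell2_nvs \<equiv> nvs_of coord"

definition finite_sphere :: "nat \<Rightarrow> ell2 set" where
  "finite_sphere n = {u. norm u = 1 \<and> (\<forall>i>n. coord u i = 0)}"

lemma closed_finite_sphere: "closed (finite_sphere n)"
  unfolding finite_sphere_def
  by (intro closed_Collect_conj closed_Collect_all closed_Collect_imp closed_Collect_eq
      open_Collect_const continuous_intros bounded_linear.continuous_on[OF bounded_linear_coord])

text \<open>
  Sequences supported on \<open>{0..n}\<close> are at the same time the points of the library's Euclidean spaces,
  so the \<open>n\<close>-sphere itself embeds as this set, and an odd map on it restricts to one on \<open>nsphere n\<close>.
\<close>

lemma genus_finite_sphere: "enat (Suc n) \<le> genus ell2_nvs (coord ` finite_sphere n)"
  unfolding genus_def
proof (rule INF_greatest)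
  let ?A = "coord ` finite_sphere n"
  fix m assume "m \<in> {n. \<exists>\<zeta>. continuous_map (subtopology (vtopology ell2_nvs) ?A)
         (subtopology (Euclidean_space n) (- {\<lambda>i. 0})) \<zeta> \<and>
       (\<forall>x\<in>?A. \<zeta> (vneg ell2_nvs x) = (\<lambda>i. - \<zeta> x i))}"
  then obtain \<zeta> where \<zeta>: "continuous_map (subtopology (vtopology ell2_nvs) ?A)
         (subtopology (Euclidean_space m) (- {\<lambda>i. 0})) \<zeta>"
    and odd: "\<And>u. u \<in> finite_sphere n \<Longrightarrow> \<zeta> (coord (- u)) = (\<lambda>i. - \<zeta> (coord u) i)"
    by auto
  define g where "g x = (\<Sum>i\<le>n. x i *\<^sub>R ell2_unit i)" for x :: "nat \<Rightarrow> real"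
  have coord_sum: "coord (\<Sum>i\<in>F. x i *\<^sub>R ell2_unit i) j = (if j \<in> F then x j else 0)"
    if "finite F" for F j and x :: "nat \<Rightarrow> real"
    using that by (induction F) auto
  have cg: "coord (g x) i = (if i \<le> n then x i else 0)" for x i
    by (simp add: g_def coord_sum)
  have gS: "g x \<in> finite_sphere n" if "x \<in> topspace (nsphere n)" for x
  proof -
    have "(norm (g x))\<^sup>2 = (\<Sum>i\<le>n. (x i)\<^sup>2)"
      unfolding norm_ell2_sq by (subst suminf_finite[of "{..n}"]) (auto simp: cg)
    then have "norm (g x) = 1"
      using that by (simp add: topspace_nsphere power2_eq_1_iff) (metis norm_ge_zero not_one_le_zero neg_0_le_iff_le)
    then show ?thesis by (simp add: finite_sphere_def cg)
  qed
  have "continuous_on UNIV g"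
    unfolding g_def by (intro continuous_intros continuous_on_product_coordinates)
  then have "continuous_on (topspace (nsphere n)) g"
    by (rule continuous_on_subset) simp
  then have "continuous_map (nsphere n) euclidean g"
    by (subst nsphere_top_of_set) simp
  then have "continuous_map (nsphere n) (subtopology (vtopology ell2_nvs) ?A) (\<lambda>x. coord (g x))"
    using gS by (auto simp: continuous_map_in_subtopology intro!: ell2.continuous_map_vtopology)
  from continuous_map_compose[OF this \<zeta>]
  have "n < m"
  proof (rule Borsuk_Ulam_nsphere)
    fix x assume x: "x \<in> topspace (nsphere n)"
    have "g (\<lambda>i. - x i) = - g x" by (simp add: g_def sum_negf)
    then show "(\<zeta> \<circ> (\<lambda>x. coord (g x))) (\<lambda>i. - x i) = (\<lambda>i. - (\<zeta> \<circ> (\<lambda>x. coord (g x))) x i)"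
      using odd[OF gS[OF x]] by simp
  qed
  then show "enat (Suc n) \<le> enat m" by simp
qed

text \<open>
  On the first \<open>n + 1\<close> coordinates all weights are at least \<open>1/(n + 1)\<close>.
\<close>

lemma energy_finite_sphere:
  assumes "u \<in> finite_sphere n"
  shows "energy u \<le> - 1 / (2 * (real n + 1))"
proof -
  have u: "norm u = 1" "\<And>i. i > n \<Longrightarrow> coord u i = 0"
    using assms by (auto simp: finite_sphere_def)
  have "(coord u i)\<^sup>2 / (real n + 1) \<le> (coord u i)\<^sup>2 / (real i + 1)" for i
    using u(2)[of i] by (cases "i \<le> n") (auto intro!: divide_left_mono)
  then have "suminf (\<lambda>i. (coord u i)\<^sup>2 / (real n + 1)) \<le> inner (weigh u) u"
    unfolding inner_weigh_eq
    by (intro suminf_le summable_inner_weigh summable_divide summable_coord_sq)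
  also have "suminf (\<lambda>i. (coord u i)\<^sup>2 / (real n + 1)) = 1 / (real n + 1)"
    using u(1) by (simp add: suminf_divide summable_coord_sq flip: norm_ell2_sq)
  finally have "1 / (real n + 1) \<le> inner (weigh u) u" .
  moreover have "energy u = - inner (weigh u) u / 2"
    using u(1) by (simp add: energy_def flip: power2_norm_eq_inner)
  ultimately show ?thesis by (simp add: field_simps)
qed

theorem theorem1p8:
  shows "\<exists>(X :: (nat \<Rightarrow> real) nvs) (I :: (nat \<Rightarrow> real) \<Rightarrow> real).
     real_banach_space X \<and> C1_functional X I \<and> A1 X I \<and> A2 X I \<and> A3 X I \<and>
     \<not> (\<exists>u :: nat \<Rightarrow> (nat \<Rightarrow> real).
          (\<forall>j. critical_point X I (u j)) \<and>
          (\<forall>j. I (u j) < 0) \<and>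
          (\<lambda>j. I (u j)) \<longlonglongrightarrow> 0 \<and>
          (\<lambda>j. set_distance X (u j) (K0_hat X I)) \<longlonglongrightarrow> 0)"
proof (intro exI conjI notI)
  let ?X = ell2_nvs
  define I where "I x = energy (Abs_ell2 x)" for x
  have I [simp]: "I (coord u) = energy u" for u by (simp add: I_def coord_inverse)
  have D: "((\<lambda>x. I (coord x)) has_derivative (\<lambda>h. inner (gradient u) h)) (at u)" for u
    using has_derivative_energy by simp
  have uminus: "energy (- u) = energy u" for u
  proof -
    have "weigh (- u) = - weigh u" by (intro ell2_eqI) simp
    then show ?thesis by (simp add: energy_def)
  qed
  show "real_banach_space ?X"
    by (intro real_banach_space_nvs_of ell2.inj)
  show "C1_functional ?X I"
    by (rule ell2.C1_functional_gradient[OF D continuous_on_gradient])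
  show "A1 ?X I"
    unfolding A1_def
  proof (intro conjI)
    show "I (vzero ?X) = 0" by (simp add: energy_eq_0_iff)
    show "\<forall>u\<in>vcarrier ?X. I (vneg ?X u) = I u" by (auto simp: uminus)
    have "- 1 \<le> energy u" for u
    proof (cases "inner u u \<le> 1")
      case True
      then show ?thesis using energy_le_inner[of u] by linarith
    next
      case False
      then have "1 * \<bar>energy u\<bar> \<le> inner u u * \<bar>energy u\<bar>"
        by (intro mult_right_mono) auto
      then show ?thesis using inner_mult_energy_le[of u] by linarith
    qed
    then show "bdd_below (I ` vcarrier ?X)"
      by (auto intro!: bdd_belowI[of _ "- 1"])
  qed
  show "A2 ?X I"
    unfolding A2_def
  proof (intro allI impI)
    fix c :: real assume "c < 0"
    then show "palais_smale ?X I c"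
      by (intro ell2.palais_smale_gradient[OF D] palais_smale_energy[of c]) simp_all
  qed
  show "A3 ?X I"
    unfolding A3_def
  proof (intro allI impI)
    fix k :: nat assume "k \<ge> 1"
    then obtain n where k: "k = Suc n" by (cases k) auto
    let ?A = "coord ` finite_sphere n"
    show "\<exists>A\<in>closed_symmetric_sets ?X. genus ?X A \<ge> enat k \<and> (SUP u\<in>A. ereal (I u)) < 0"
    proof (intro bexI[of _ ?A] conjI)
      show "enat k \<le> genus ?X ?A" unfolding k by (rule genus_finite_sphere)
      have "(SUP u\<in>?A. ereal (I u)) \<le> ereal (- 1 / (2 * (real n + 1)))"
      proof (rule SUP_least)
        fix x assume "x \<in> ?A"
        then obtain u where u: "x = coord u" "u \<in> finite_sphere n" by blast
        show "ereal (I x) \<le> ereal (- 1 / (2 * (real n + 1)))"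
          unfolding u(1) I ereal_less_eq by (rule energy_finite_sphere[OF u(2)])
      qed
      also have "\<dots> < 0" by (simp add: zero_ereal_def)
      finally show "(SUP u\<in>?A. ereal (I u)) < 0" .
      have "0 \<notin> finite_sphere n" by (simp add: finite_sphere_def)
      then have "vzero ?X \<notin> ?A" by (auto simp: coord_inject)
      moreover have "vneg ?X x \<in> ?A" if "x \<in> ?A" for x
        using that by (auto simp: finite_sphere_def)
      ultimately show "?A \<in> closed_symmetric_sets ?X"
        by (simp add: closed_symmetric_sets_def ell2.closedin_vtopology closed_finite_sphere)
    qed
  qed
  have crit: "critical_point ?X I (coord u) \<longleftrightarrow> gradient u = 0" for u
    by (rule ell2.critical_point_gradient[OF D])
  have K0: "K0 ?X I = {coord 0}"
  proof -
    have "x = coord 0" if x: "x \<in> K0 ?X I" for x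
    proof -
      obtain u where u: "x = coord u"
        using x by (auto simp: K0_def critical_point_def)
      then have "energy u = 0" using x by (simp add: K0_def)
      then show ?thesis by (simp add: u energy_eq_0_iff)
    qed
    moreover have "coord 0 \<in> K0 ?X I"
      by (simp add: K0_def crit gradient_0 energy_eq_0_iff)
    ultimately show ?thesis by blast
  qed
  have K0_hat: "K0_hat ?X I = {coord 0}"
  proof -
    let ?T = "subtopology (vtopology ?X) (K0 ?X I)"
    have top: "topspace ?T = {coord 0}"
      using K0 by auto
    have "connected_component_of_set ?T (coord 0) \<subseteq> topspace ?T"
      by (rule connected_component_of_subset_topspace)
    moreover have "coord 0 \<in> connected_component_of_set ?T (coord 0)"
      using top by (simp add: connected_component_of_refl)
    ultimately show ?thesis using top by (auto simp: K0_hat_def)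
  qed
  assume "\<exists>u :: nat \<Rightarrow> nat \<Rightarrow> real. (\<forall>j. critical_point ?X I (u j)) \<and> (\<forall>j. I (u j) < 0) \<and>
    (\<lambda>j. I (u j)) \<longlonglongrightarrow> 0 \<and> (\<lambda>j. set_distance ?X (u j) (K0_hat ?X I)) \<longlonglongrightarrow> 0"
  then obtain v where v: "\<And>j. critical_point ?X I (v j)" "\<And>j. I (v j) < 0"
    and lim: "(\<lambda>j. set_distance ?X (v j) (K0_hat ?X I)) \<longlonglongrightarrow> 0"
    by blast
  have "set_distance ?X (v j) (K0_hat ?X I) = 1" for j
  proof -
    obtain u where u: "v j = coord u"
      using v(1)[of j] by (auto simp: critical_point_def)
    have "norm u = 1"
      using v(1)[of j] v(2)[of j] by (intro norm_critical_point) (simp_all add: u crit)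
    then show ?thesis
      by (simp add: K0_hat set_distance_def u)
  qed
  with lim show False by (simp add: LIMSEQ_const_iff)
qed

end
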